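(* Let $n\ge2$, $(t_0,u_0,t,t_n,u_n)\in\mathbb C^5$, and let $H$ be the algebra generated by $T_0,\dots,T_n$ defined in the context. For every $w\in W$ let $\overline w$ be a fixed reduced expression $s_{i_1}\cdots s_{i_r}$ for $w$ in the generators $s_0,\dots,s_n$, and put $T_{\overline w}=T_{i_1}\cdots T_{i_r}$. Then $\{T_{\overline w}\mid w\in W\}$ is a linear basis of $H$.
   Context: Notation: $[m,n]=\{m,m+1,\dots,n\}$. $W$ is the affine Weyl group of type $\widetilde C_n$: the Coxeter group with generators $s_0,\dots,s_n$ and relations $s_i^2=1$; $s_is_{i+1}s_is_{i+1}=s_{i+1}s_is_{i+1}s_i$ for $i=0,n-1$; $s_is_{i+1}s_i=s_{i+1}s_is_{i+1}$ for $i\in[1,n-2]$; $s_is_j=s_js_i$ for $|i-j|\ge2$. $W$ acts on $\mathbb C^n$ by $s_0x=(1-x_1,x_2,\dots,x_n)$, $s_i$ interchanges $x_i$ and $x_{i+1}$ ($i\in[1,n-1]$), $s_nx=(x_1,\dots,x_{n-1},-x_n)$, and on $\mathcal P=\mathbb C[x_1,\dots,x_n]$ by $(wp)(x)=p(w^{-1}x)$. Put $a_0(x)=1-2x_1$, $a_i(x)=x_i-x_{i+1}$ ($i\in[1,n-1]$), $a_n(x)=2x_n$, and $a_0^\vee(x)=\tfrac12-x_1$, $a_n^\vee(x)=x_n$. Put $k_0=2t_0+2u_0$, $k_i=t$ for $i\in[1,n-1]$, $k_n=2t_n+2u_n$. The degenerate (trigonometric) double affine Hecke algebra $\mathfrak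 H(\mathbf k)$ is the unital associative complex algebra generated by the group algebra $\mathbb C[W]$ (with generators $r_0,\dots,r_n$ corresponding to $s_0,\dots,s_n$) and the polynomial algebra $\mathbb C[X_1,\dots,X_n]$, such that $\mathfrak H(\mathbf k)\simeq\mathbb C[W]\otimes\mathbb C[X_1,\dots,X_n]$ as a vector space via multiplication, with cross-relations $$r_ip(X)-(s_ip)(X)r_i=\frac{k_i}{a_i(X)}\big((s_ip)(X)-p(X)\big),\qquad i\in[0,n],\ p\in\mathcal P .$$ $H$ is the subalgebra of $\mathfrak H(\mathbf k)$ generated by $T_i=r_i$ ($i\in[1,n-1]$) and $T_i=t_i+\tfrac12\big(t_i-u_i+a_i^\vee(X)\big)(r_i-1)$ for $i=0,n$. *)

theory Defs
  imports Complex_Main "HOL-Library.Poly_Mapping" "HOL-Algebra.Group"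
begin

definition coxeter_relations :: "nat \<Rightarrow> (nat list \<times> nat list) set" where
  "coxeter_relations n =
     {([i, i], []) | i. i \<le> n}
   \<union> {([i, i + 1, i, i + 1], [i + 1, i, i + 1, i]) | i. i \<in> {0, n - 1}}
   \<union> {([i, i + 1, i], [i + 1, i, i + 1]) | i. i \<in> {1..n - 2}}
   \<union> {([i, j], [j, i]) | i j. i \<le> n \<and> j \<le> n \<and> (i + 2 \<le> j \<or> j + 2 \<le> i)}"

inductive word_equiv :: "nat \<Rightarrow> nat list \<Rightarrow> nat list \<Rightarrow> bool" for n :: nat where
  word_equiv_refl: "set u \<subseteq> {0..n} \<Longrightarrow> word_equiv n u u"
| word_equiv_sym: "word_equiv n u v \<Longrightarrow> word_equiv n v u"
| word_equiv_trans: "word_equiv n u v \<Longrightarrow> word_equiv n v w \<Longrightarrow> word_equiv n u w"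
| word_equiv_rel: "(u, v) \<in> coxeter_relations n \<Longrightarrow> set a \<subseteq> {0..n} \<Longrightarrow> set b \<subseteq> {0..n}
     \<Longrightarrow> word_equiv n (a @ u @ b) (a @ v @ b)"

definition word_class :: "nat \<Rightarrow> nat list \<Rightarrow> nat list set" where
  "word_class n u = {v. word_equiv n u v}"

text \<open>The group is the presented monoid (the involution relations make every generator invertible).
  An element is literally the set of all words \<open>[i\<^sub>1, \<dots>, i\<^sub>r]\<close> with
  \<open>s\<^bsub>i\<^sub>1\<^esub> \<cdots> s\<^bsub>i\<^sub>r\<^esub>\<close> equal to it.\<close>

definition affine_weyl :: "nat \<Rightarrow> nat list set monoid" where
  "affine_weyl n =
     \<lparr>carrier = word_class n ` {u. set u \<subseteq> {0..n}},
      monoid.mult = (\<lambda>g h. \<Union>u\<in>g. \<Union>v\<in>h. word_class n (u @ v)),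
      one = word_class n []\<rparr>"

abbreviation simple_refl :: "nat \<Rightarrow> nat \<Rightarrow> nat list set" where
  "simple_refl n i \<equiv> word_class n [i]"

definition reduced_expression :: "nat list set \<Rightarrow> nat list \<Rightarrow> bool" where
  "reduced_expression w u \<longleftrightarrow> u \<in> w \<and> (\<forall>v\<in>w. length u \<le> length v)"

type_synonym mpoly = "(nat \<Rightarrow>\<^sub>0 nat) \<Rightarrow>\<^sub>0 complex"

definition polys :: "nat \<Rightarrow> mpoly set" where
  "polys n = {p. \<forall>m\<in>Poly_Mapping.keys p. Poly_Mapping.keys m \<subseteq> {1..n}}"

definition Const :: "complex \<Rightarrow> mpoly" where
  "Const c = Poly_Mapping.single 0 c"

definition Var :: "nat \<Rightarrow> mpoly" where
  "Var i = Poly_Mapping.single (Poly_Mapping.single i 1) 1"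

text \<open>The value \<open>p(y\<^sub>1, \<dots>, y\<^sub>n)\<close> in a ring that receives the scalars through \<open>\<iota>\<close>. The factors of
  each monomial are multiplied in the order \<open>1, \<dots>, n\<close>, as the ring need not be commutative; it is
  only used for pairwise commuting \<open>y\<^sub>j\<close>.\<close>

definition poly_value :: "nat \<Rightarrow> (complex \<Rightarrow> 'b::ring_1) \<Rightarrow> (nat \<Rightarrow> 'b) \<Rightarrow> mpoly \<Rightarrow> 'b" where
  "poly_value n \<iota> y p =
     (\<Sum>m\<in>Poly_Mapping.keys p. \<iota> (Poly_Mapping.lookup p m) *
        (\<Prod>j\<leftarrow>[1..<n + 1]. y j ^ Poly_Mapping.lookup m j))"

text \<open>The action of \<open>s\<^sub>i\<close> on points \<open>(x\<^sub>1, \<dots>, x\<^sub>n)\<close>, over any coefficient ring.\<close>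

definition refl_point :: "nat \<Rightarrow> nat \<Rightarrow> (nat \<Rightarrow> 'b::ring_1) \<Rightarrow> nat \<Rightarrow> 'b" where
  "refl_point n i x =
     (if i = 0 then x(1 := 1 - x 1)
      else if i = n then x(n := - x n)
      else x(i := x (i + 1), i + 1 := x i))"

text \<open>\<open>(s\<^sub>i p)(x) = p(s\<^sub>i\<inverse> x)\<close>, where \<open>s\<^sub>i\<inverse> = s\<^sub>i\<close>; here \<open>x\<close> is the generic point.\<close>

definition refl_poly :: "nat \<Rightarrow> nat \<Rightarrow> mpoly \<Rightarrow> mpoly" where
  "refl_poly n i p = poly_value n Const (refl_point n i Var) p"

definition affine_root :: "nat \<Rightarrow> nat \<Rightarrow> mpoly" where
  "affine_root n i =
     (if i = 0 then Const 1 - Const 2 * Var 1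
      else if i = n then Const 2 * Var n
      else Var i - Var (i + 1))"

text \<open>Only used for \<open>i = 0\<close> and \<open>i = n\<close>.\<close>

definition coroot :: "nat \<Rightarrow> nat \<Rightarrow> mpoly" where
  "coroot n i = (if i = 0 then Const (1 / 2) - Var 1 else Var n)"

definition mult_param ::
    "nat \<Rightarrow> complex \<Rightarrow> complex \<Rightarrow> complex \<Rightarrow> complex \<Rightarrow> complex \<Rightarrow> nat \<Rightarrow> complex" where
  "mult_param n t0 u0 t tn un i =
     (if i = 0 then 2 * t0 + 2 * u0 else if i = n then 2 * tn + 2 * un else t)"

abbreviation poly_at ::
    "(complex \<Rightarrow> 'a \<Rightarrow> 'a::ring_1) \<Rightarrow> nat \<Rightarrow> (nat \<Rightarrow> 'a) \<Rightarrow> mpoly \<Rightarrow> 'a" where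
  "poly_at sc n X p \<equiv> poly_value n (\<lambda>c. sc c 1) X p"

text \<open>The type \<open>'a\<close> with scalar multiplication \<open>sc\<close>, the images \<open>\<rho> w\<close> of the elements of the group
  and the elements \<open>X 1, \<dots>, X n\<close> is the algebra \<open>\<HH>(k)\<close>. The homomorphism from the group algebra is
  given by its restriction \<open>\<rho>\<close> to the group, and \<open>r\<^sub>i = \<rho> s\<^sub>i\<close>.

  In \<open>cross_relation\<close>, \<open>q\<close> is the polynomial \<open>(s\<^sub>i p - p) / a\<^sub>i\<close>.

  In \<open>pbw\<close>, the tensor product of the group algebra and \<open>\<complex>[X]\<close> is written as the direct sum of copies
  of \<open>\<complex>[X]\<close> indexed by the group, that is, as the space of finitely supported functions \<open>F\<close> from the
  group to polynomials, \<open>F\<close> corresponding to \<open>\<Sum>\<^sub>w w \<otimes> F(w)\<close>. The map in \<open>pbw\<close> is then the (linear)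
  multiplication map; its bijectivity also yields that the group algebra and \<open>\<complex>[X]\<close> embed and
  together generate the algebra.\<close>

locale degenerate_daha = vector_space sc
  for sc :: "complex \<Rightarrow> 'a::ring_1 \<Rightarrow> 'a" +
  fixes n :: nat and t0 u0 t tn un :: complex
    and \<rho> :: "nat list set \<Rightarrow> 'a" and X :: "nat \<Rightarrow> 'a"
  assumes scale_mult_left: "\<And>c x y. sc c x * y = sc c (x * y)"
    and scale_mult_right: "\<And>c x y. x * sc c y = sc c (x * y)"
    and rho_one: "\<rho> \<one>\<^bsub>affine_weyl n\<^esub> = 1"
    and rho_mult: "\<And>g h. \<lbrakk>g \<in> carrier (affine_weyl n); h \<in> carrier (affine_weyl n)\<rbrakk>
          \<Longrightarrow> \<rho> (g \<otimes>\<^bsub>affine_weyl n\<^esub> h) = \<rho> g * \<rho> h"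
    and X_commute: "\<And>i j. \<lbrakk>i \<in> {1..n}; j \<in> {1..n}\<rbrakk> \<Longrightarrow> X i * X j = X j * X i"
    and cross_relation: "\<And>i p q. \<lbrakk>i \<in> {0..n}; p \<in> polys n; q \<in> polys n;
            affine_root n i * q = refl_poly n i p - p\<rbrakk>
          \<Longrightarrow> \<rho> (simple_refl n i) * poly_at sc n X p
                - poly_at sc n X (refl_poly n i p) * \<rho> (simple_refl n i)
              = sc (mult_param n t0 u0 t tn un i) (poly_at sc n X q)"
    and pbw: "bij_betw
          (\<lambda>F :: nat list set \<Rightarrow>\<^sub>0 mpoly.
             \<Sum>w\<in>Poly_Mapping.keys F. \<rho> w * poly_at sc n X (Poly_Mapping.lookup F w))
          {F. Poly_Mapping.keys F \<subseteq> carrier (affine_weyl n) \<and>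
              (\<forall>w. Poly_Mapping.lookup F w \<in> polys n)}
          UNIV"

definition T_gen ::
    "(complex \<Rightarrow> 'a \<Rightarrow> 'a::ring_1) \<Rightarrow> nat \<Rightarrow> complex \<Rightarrow> complex \<Rightarrow> complex \<Rightarrow> complex
       \<Rightarrow> (nat list set \<Rightarrow> 'a) \<Rightarrow> (nat \<Rightarrow> 'a) \<Rightarrow> nat \<Rightarrow> 'a" where
  "T_gen sc n t0 u0 tn un \<rho> X i =
     (let r = \<rho> (simple_refl n i);
          end_gen = (\<lambda>ti ui. sc ti 1
            + sc (1 / 2) ((sc (ti - ui) 1 + poly_at sc n X (coroot n i)) * (r - 1)))
      in if i = 0 then end_gen t0 u0 else if i = n then end_gen tn un else r)"

definition T_word ::
    "(complex \<Rightarrow> 'a \<Rightarrow> 'a::ring_1) \<Rightarrow> nat \<Rightarrow> complex \<Rightarrow> complex \<Rightarrow> complex \<Rightarrow> complex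
       \<Rightarrow> (nat list set \<Rightarrow> 'a) \<Rightarrow> (nat \<Rightarrow> 'a) \<Rightarrow> nat list \<Rightarrow> 'a" where
  "T_word sc n t0 u0 tn un \<rho> X u = (\<Prod>i\<leftarrow>u. T_gen sc n t0 u0 tn un \<rho> X i)"

definition unital_subalgebra :: "(complex \<Rightarrow> 'a \<Rightarrow> 'a::ring_1) \<Rightarrow> 'a set \<Rightarrow> bool" where
  "unital_subalgebra sc S \<longleftrightarrow>
     module.subspace sc S \<and> 1 \<in> S \<and> (\<forall>x\<in>S. \<forall>y\<in>S. x * y \<in> S)"

definition H_alg ::
    "(complex \<Rightarrow> 'a \<Rightarrow> 'a::ring_1) \<Rightarrow> nat \<Rightarrow> complex \<Rightarrow> complex \<Rightarrow> complex \<Rightarrow> complex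
       \<Rightarrow> (nat list set \<Rightarrow> 'a) \<Rightarrow> (nat \<Rightarrow> 'a) \<Rightarrow> 'a set" where
  "H_alg sc n t0 u0 tn un \<rho> X =
     unital_subalgebra sc hull (T_gen sc n t0 u0 tn un \<rho> X ` {0..n})"

end

theory Submission
  imports Defs
begin

text \<open>
  The \<open>T\<^sub>i\<close> satisfy \<open>T\<^sub>i\<^sup>2 = 1\<close> or \<open>T\<^sub>i\<^sup>2 = t\<^sub>i\<^sup>2\<close>, and the braid relations of the Coxeter group, except that
  \<open>T\<^sub>n T\<^sub>n\<^sub>-\<^sub>1 T\<^sub>n T\<^sub>n\<^sub>-\<^sub>1 - T\<^sub>n\<^sub>-\<^sub>1 T\<^sub>n T\<^sub>n\<^sub>-\<^sub>1 T\<^sub>n = t (T\<^sub>n\<^sub>-\<^sub>1 T\<^sub>n - T\<^sub>n T\<^sub>n\<^sub>-\<^sub>1)\<close> and likewise for \<open>T\<^sub>0\<close>, \<open>T\<^sub>1\<close>. So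
  braid moves change a product of \<open>T\<^sub>i\<close>'s only by shorter products. By the theorems of Matsumoto and Tits
  (two reduced words of an element differ by braid moves, and a non-reduced word can be moved to one
  containing a square), induction on the length shows that the chosen products span.

  For independence, \<open>T\<^sub>i = f\<^sub>i(X) r\<^sub>i + g\<^sub>i(X)\<close> with \<open>f\<^sub>i \<noteq> 0\<close>, so the product along a reduced word of \<open>w\<close> is
  \<open>w p(X)\<close> with \<open>p \<noteq> 0\<close> up to terms \<open>v q(X)\<close> with \<open>v\<close> shorter than \<open>w\<close>. In a linear relation, compare the
  coefficients of a longest \<open>w\<close>.
\<close>

section \<open>Words in the Coxeter group\<close>

lemma word_equiv_words:
  assumes "word_equiv n u v" "2 \<le> n"
  shows "set u \<subseteq> {0..n} \<and> set v \<subseteq> {0..n}"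
  using assms by induction (auto simp: coxeter_relations_def)

lemma word_equiv_append_left:
  assumes "word_equiv n u v" "set a \<subseteq> {0..n}"
  shows "word_equiv n (a @ u) (a @ v)"
  using assms
proof induction
  case (word_equiv_rel u v b c)
  then show ?case using word_equiv.word_equiv_rel[of u v n "a @ b" c] by simp
next
  case (word_equiv_refl u)
  then show ?case by (intro word_equiv.word_equiv_refl) auto
qed (blast intro: word_equiv_sym word_equiv_trans)+

lemma word_equiv_append_right:
  assumes "word_equiv n u v" "set a \<subseteq> {0..n}"
  shows "word_equiv n (u @ a) (v @ a)"
  using assms
proof induction
  case (word_equiv_rel u v b c)
  then show ?case using word_equiv.word_equiv_rel[of u v n b "c @ a"] by simp
next
  case (word_equiv_refl u)
  then show ?case by (intro word_equiv.word_equiv_refl) auto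
qed (blast intro: word_equiv_sym word_equiv_trans)+

text \<open>Reversal is inversion in the group, the generators being involutions. Reversing both
  sides of a defining relation gives a defining relation again, possibly with its sides
  exchanged.\<close>

lemma word_equiv_rev:
  assumes "word_equiv n u v"
  shows "word_equiv n (rev u) (rev v)"
  using assms
proof induction
  case (word_equiv_rel u v a b)
  then have "(rev u, rev v) \<in> coxeter_relations n \<or> (rev v, rev u) \<in> coxeter_relations n"
    by (auto simp: coxeter_relations_def)
  then show ?case
    using word_equiv_rel word_equiv.word_equiv_rel[of "rev u" "rev v" n "rev b" "rev a"]
      word_equiv.word_equiv_rel[of "rev v" "rev u" n "rev b" "rev a"]
    by (auto intro: word_equiv_sym)
next
  case (word_equiv_refl u)
  then show ?case by (intro word_equiv.word_equiv_refl) auto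
qed (blast intro: word_equiv_sym word_equiv_trans)+

lemma word_equiv_square: "i \<le> n \<Longrightarrow> word_equiv n [i, i] []"
  using word_equiv_rel[of "[i, i]" "[]" n "[]" "[]"] by (auto simp: coxeter_relations_def)

lemma word_equiv_cancel_square:
  assumes "i \<le> n" "set u \<subseteq> {0..n}"
  shows "word_equiv n (i # i # u) u"
  using word_equiv_append_right[OF word_equiv_square[OF assms(1)] assms(2)] by simp

lemma word_equiv_Cons: "word_equiv n u v \<Longrightarrow> i \<le> n \<Longrightarrow> word_equiv n (i # u) (i # v)"
  using word_equiv_append_left[of n u v "[i]"] by simp

lemma word_equiv_Cons_iff:
  assumes "i \<le> n" "set u \<subseteq> {0..n}" "set v \<subseteq> {0..n}"
  shows "word_equiv n (i # u) v \<longleftrightarrow> word_equiv n u (i # v)"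
  by (meson assms word_equiv_Cons word_equiv_cancel_square word_equiv_sym word_equiv_trans)

lemma word_equiv_snoc_iff:
  assumes "i \<le> n" "set u \<subseteq> {0..n}" "set v \<subseteq> {0..n}"
  shows "word_equiv n (u @ [i]) v \<longleftrightarrow> word_equiv n u (v @ [i])"
  using word_equiv_Cons_iff[of i n "rev u" "rev v"] word_equiv_rev[of n] assms
  by (metis rev.simps(2) rev_rev_ident set_rev)

lemma word_equiv_append_right_cancel:
  assumes "word_equiv n (u @ a) (v @ a)"
    and "set u \<subseteq> {0..n}" "set v \<subseteq> {0..n}" "set a \<subseteq> {0..n}"
  shows "word_equiv n u v"
  using assms
proof (induction a rule: rev_induct)
  case (snoc i a)
  then have "word_equiv n (u @ a) ((v @ a @ [i]) @ [i])"
    using word_equiv_snoc_iff[of i n "u @ a" "v @ a @ [i]"] by auto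
  moreover have "word_equiv n (v @ a @ [i, i]) (v @ a)"
    using word_equiv_append_left[OF word_equiv_square[of i n], of "v @ a"] snoc.prems by auto
  ultimately show ?case
    using snoc by (auto intro: word_equiv_trans)
qed simp

lemma word_equiv_conj_iff:
  assumes "i \<le> n" "set u \<subseteq> {0..n}" "set v \<subseteq> {0..n}"
  shows "word_equiv n (i # u @ [i]) v \<longleftrightarrow> word_equiv n u (i # v @ [i])"
  using word_equiv_Cons_iff[of i n "u @ [i]" v] word_equiv_snoc_iff[of i n u "i # v"] assms by auto

section \<open>The Coxeter matrix and alternating words\<close>

text \<open>For distinct \<open>i\<close> and \<open>j\<close> this is the entry \<open>m_ij\<close>
  of the Coxeter matrix. For neighbours, \<open>min i j\<close> names the edge of the diagram; the
  first and the last edge carry the label 4.\<close>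

definition coxeter_order :: "nat \<Rightarrow> nat \<Rightarrow> nat \<Rightarrow> nat" where
  "coxeter_order n i j =
     (if i + 2 \<le> j \<or> j + 2 \<le> i then 2
      else if min i j \<in> {0, n - 1} then 4 else 3)"

fun alternating :: "nat \<Rightarrow> nat \<Rightarrow> nat \<Rightarrow> nat list" where
  "alternating i j 0 = []"
| "alternating i j (Suc k) = i # alternating j i k"

lemma coxeter_order_sym: "coxeter_order n i j = coxeter_order n j i"
  by (auto simp: coxeter_order_def min.commute)

lemma length_alternating [simp]: "length (alternating i j k) = k"
  by (induction k arbitrary: i j) auto

lemma set_alternating: "i \<le> n \<Longrightarrow> j \<le> n \<Longrightarrow> set (alternating i j k) \<subseteq> {0..n}"
  by (induction k arbitrary: i j) auto

text \<open>Brings the four families of relations into the uniform shape of a Coxeter presentation,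
  squares and braid relations of length \<open>m_ij\<close>, so that later arguments see only
  \<open>coxeter_order\<close> and not the diagram.\<close>

lemma coxeter_relations_cases:
  assumes "(u, v) \<in> coxeter_relations n" "2 \<le> n"
  obtains i where "i \<le> n" "u = [i, i]" "v = []"
  | i j where "i \<le> n" "j \<le> n" "i \<noteq> j"
      "u = alternating i j (coxeter_order n i j)" "v = alternating j i (coxeter_order n i j)"
proof -
  from assms consider i where "i \<le> n" "u = [i, i]" "v = []"
    | i where "i \<in> {0, n - 1}" "u = [i, i + 1, i, i + 1]" "v = [i + 1, i, i + 1, i]"
    | i where "i \<in> {1..n - 2}" "u = [i, i + 1, i]" "v = [i + 1, i, i + 1]"
    | i j where "i \<le> n" "j \<le> n" "i + 2 \<le> j \<or> j + 2 \<le> i" "u = [i, j]" "v = [j, i]"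
    by (auto simp: coxeter_relations_def)
  then show ?thesis
  proof cases
    case (2 i)
    with assms have "i \<le> n" "i + 1 \<le> n" by auto
    with 2 show ?thesis
      by (intro that(2)[of i "i + 1"]) (auto simp: coxeter_order_def eval_nat_numeral)
  next
    case (3 i)
    with assms have "i \<le> n" "i + 1 \<le> n" by auto
    with 3 assms show ?thesis
      by (intro that(2)[of i "i + 1"]) (auto simp: coxeter_order_def eval_nat_numeral)
  next
    case (4 i j)
    then show ?thesis
      by (intro that(2)[of i j]) (auto simp: coxeter_order_def eval_nat_numeral)
  qed (use that in blast)
qed

lemma alternating_relation:
  assumes "i \<le> n" "j \<le> n" "i < j" "2 \<le> n"
  shows "(alternating i j (coxeter_order n i j), alternating j i (coxeter_order n i j))
    \<in> coxeter_relations n"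
proof (cases "j = i + 1")
  case True
  with assms show ?thesis
    by (cases "i \<in> {0, n - 1}")
      (auto simp: coxeter_order_def coxeter_relations_def eval_nat_numeral)
next
  case False
  with assms show ?thesis
    by (auto simp: coxeter_order_def coxeter_relations_def eval_nat_numeral)
qed

lemma word_equiv_alternating:
  assumes "i \<le> n" "j \<le> n" "i \<noteq> j" "2 \<le> n"
  shows "word_equiv n (alternating i j (coxeter_order n i j)) (alternating j i (coxeter_order n i j))"
  using alternating_relation[of i n j] alternating_relation[of j n i] assms
    word_equiv_rel[of "alternating i j (coxeter_order n i j)" _ n "[]" "[]"]
    word_equiv_rel[of "alternating j i (coxeter_order n j i)" _ n "[]" "[]"]
  by (auto simp: coxeter_order_sym[of n j i] neq_iff intro: word_equiv_sym)

text \<open>The reflections of points satisfy the defining relations, so a word acts through its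
  group element. Integer points suffice for telling apart the short words below.\<close>

lemma word_equiv_foldr_refl_point:
  fixes x :: "nat \<Rightarrow> int"
  assumes "word_equiv n u v" "2 \<le> n"
  shows "foldr (refl_point n) u x = foldr (refl_point n) v x"
  using assms
proof (induction arbitrary: x)
  case (word_equiv_rel u v a b)
  have "foldr (refl_point n) u y = foldr (refl_point n) v y" for y :: "nat \<Rightarrow> int"
    using word_equiv_rel(1) \<open>2 \<le> n\<close>
    by (auto simp: coxeter_relations_def refl_point_def fun_eq_iff)
  then show ?case by simp
qed auto

text \<open>The alternating words of length below \<open>coxeter_order\<close> are told apart by the images of a generic
  point.\<close>

lemma not_word_equiv_alternating:
  assumes "i \<le> n" "j \<le> n" "i \<noteq> j" "2 \<le> n" "0 < k" "k < coxeter_order n i j"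
  shows "\<not> word_equiv n (alternating i j k) (alternating j i k)"
proof -
  have *: "\<not> word_equiv n (alternating i j k) (alternating j i k)"
    if "i < j" "j \<le> n" "0 < k" "k < coxeter_order n i j" for i j
  proof
    assume "word_equiv n (alternating i j k) (alternating j i k)"
    \<comment> \<open>The coordinates \<open>2 * l + 3\<close> with \<open>1 \<le> l\<close> are
      distinct and positive, while \<open>1 - x 1\<close> and \<open>- x n\<close> are negative.
      This separates the words in question, which have at most three letters.\<close>
    from word_equiv_foldr_refl_point[OF this \<open>2 \<le> n\<close>, of "\<lambda>l. 2 * int l + 3"]
    have eq: "foldr (refl_point n) (alternating i j k) (\<lambda>l. 2 * int l + 3) l
      = foldr (refl_point n) (alternating j i k) (\<lambda>l. 2 * int l + 3) l" for l
      by simp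
    have "k < 4" "0 < k" using that by (auto simp: coxeter_order_def split: if_splits)
    then consider "k = 1" | "k = 2" | "k = 3" by linarith
    then show False
    proof cases
      case 1
      then show ?thesis using eq[of i] eq[of "Suc i"] eq[of j] that \<open>2 \<le> n\<close>
        by (auto simp: refl_point_def split: if_splits)
    next
      case 2
      then have "j = Suc i" using that by (auto simp: coxeter_order_def split: if_splits)
      then show ?thesis using 2 eq[of i] eq[of "Suc i"] eq[of j] eq[of "Suc j"] that \<open>2 \<le> n\<close>
        by (auto simp: refl_point_def eval_nat_numeral split: if_splits)
    next
      case 3
      then have "j = Suc i" "i \<in> {0, n - 1}"
        using that by (auto simp: coxeter_order_def split: if_splits)
      then show ?thesis using 3 eq[of i] eq[of "Suc i"] eq[of j] eq[of "Suc j"] that \<open>2 \<le> n\<close>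
        by (auto simp: refl_point_def eval_nat_numeral split: if_splits)
    qed
  qed
  show ?thesis
    using *[of i j] *[of j i] assms coxeter_order_sym[of n i j]
    by (auto simp: neq_iff intro: word_equiv_sym)
qed

section \<open>The exchange condition and Matsumoto's theorem\<close>

text \<open>The parity of the number of factorisations \<open>u = a @ i # b\<close> for which \<open>v\<close> represents the
  reflection \<open>a i a\<inverse>\<close>. It only depends on the group elements, and it detects
  whether multiplication by a reflection \<open>v\<close> shortens \<open>u\<close>.\<close>

fun reflection_parity :: "nat \<Rightarrow> nat list \<Rightarrow> nat list \<Rightarrow> bool" where
  "reflection_parity n [] v = False"
| "reflection_parity n (i # u) v = (word_equiv n v [i] \<noteq> reflection_parity n u (i # v @ [i]))"

lemma reflection_parity_cong_right:
  assumes "word_equiv n v v'" "set u \<subseteq> {0..n}"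
  shows "reflection_parity n u v = reflection_parity n u v'"
  using assms
proof (induction u arbitrary: v v')
  case (Cons i u)
  then have "word_equiv n (i # v @ [i]) (i # v' @ [i])"
    by (auto intro!: word_equiv_Cons word_equiv_append_right)
  with Cons have "reflection_parity n u (i # v @ [i]) = reflection_parity n u (i # v' @ [i])"
    by auto
  moreover have "word_equiv n v [i] = word_equiv n v' [i]"
    using Cons.prems by (blast intro: word_equiv_sym word_equiv_trans)
  ultimately show ?case by simp
qed simp

text \<open>The cocycle rule \<open>N(u u') = N(u) + u N(u') u^(-1)\<close> modulo 2: inequality of
  truth values is addition modulo 2, and \<open>rev u\<close> represents the inverse of
  \<open>u\<close>.\<close>

lemma reflection_parity_append:
  "reflection_parity n (u @ u') v =
     (reflection_parity n u v \<noteq> reflection_parity n u' (rev u @ v @ u))"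
  by (induction u arbitrary: v) auto

text \<open>For a square, the two factorisations give the same reflection \<open>i\<close> and
  cancel. For a braid relation, \<open>i\<close>, \<open>iji\<close>, \<open>ijiji\<close>, ... and
  \<open>j\<close>, \<open>jij\<close>, \<open>jijij\<close>, ..., each with \<open>m_ij\<close>
  members, are the same reflections of a dihedral group in opposite order. The facts
  \<open>conj\<close>, \<open>conj2\<close> and \<open>conj3\<close> move a conjugation of
  \<open>v\<close> to the other side, so that \<open>v\<close> is compared with these
  palindromes.\<close>

lemma reflection_parity_relation:
  assumes "(u, u') \<in> coxeter_relations n" "set v \<subseteq> {0..n}" "2 \<le> n"
  shows "reflection_parity n u v = reflection_parity n u' v"
  using assms(1,3)
proof (cases rule: coxeter_relations_cases)
  case (1 i)
  have "word_equiv n [i, i, i] [i]"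
    using word_equiv_cancel_square[of i n "[i]"] 1 by simp
  then have "word_equiv n (i # v @ [i]) [i] = word_equiv n v [i]"
    using word_equiv_conj_iff[of i n v "[i]", simplified] 1 assms(2)
    by (meson word_equiv_trans word_equiv_sym)
  with 1 show ?thesis by simp
next
  case (2 i j)
  have eq: "word_equiv n v w = word_equiv n v w'" if "word_equiv n w w'" for w w'
    using that by (blast intro: word_equiv_trans word_equiv_sym)
  have cancel: "word_equiv n (a @ [k, k] @ b) (a @ b)" 
    if "k \<le> n" "set a \<subseteq> {0..n}" "set b \<subseteq> {0..n}" for a b k
    using that by (intro word_equiv_append_left) (auto intro: word_equiv_cancel_square)
  have conj: "word_equiv n (k # w @ [k]) w' = word_equiv n w (k # w' @ [k])"
    if "k \<le> n" "set w \<subseteq> {0..n}" "set w' \<subseteq> {0..n}" for k w w'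
    using word_equiv_conj_iff[of k n w w'] that by simp
  have conj2: "word_equiv n (k # l # w @ [l, k]) w' = word_equiv n w (l # k # w' @ [k, l])"
    if "k \<le> n" "l \<le> n" "set w \<subseteq> {0..n}" "set w' \<subseteq> {0..n}" for k l w w'
    using conj[of k "l # w @ [l]" w'] conj[of l w "k # w' @ [k]"] that by simp
  have conj3: "word_equiv n (k # l # m # w @ [m, l, k]) w' = word_equiv n w (m # l # k # w' @ [k, l, m])"
    if "k \<le> n" "l \<le> n" "m \<le> n" "set w \<subseteq> {0..n}" "set w' \<subseteq> {0..n}" for k l m w w'
    using conj2[of k l "m # w @ [m]" w'] conj[of m w "l # k # w' @ [k, l]"] that by simp
  have rel: "word_equiv n (alternating i j (coxeter_order n i j) @ w)
       (alternating j i (coxeter_order n i j) @ w)" if "set w \<subseteq> {0..n}" for w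
    using word_equiv_append_right[OF word_equiv_alternating] 2 assms(3) that by blast
  have "coxeter_order n i j \<in> {2, 3, 4}"
    by (auto simp: coxeter_order_def)
  then consider (two) "coxeter_order n i j = 2" | (three) "coxeter_order n i j = 3"
    | (four) "coxeter_order n i j = 4" by blast
  then show ?thesis
  proof cases
    case two
    have rel': "word_equiv n (i # j # w) (j # i # w)" if "set w \<subseteq> {0..n}" for w
      using rel[OF that] two by (simp add: eval_nat_numeral)
    have "word_equiv n [i, j, i] [j]"
      using word_equiv_trans[OF rel'[of "[i]"] cancel[of i "[j]" "[]", simplified]] 2 two
      by (auto simp: eval_nat_numeral)
    moreover have "word_equiv n [j, i, j] [i]"
      using word_equiv_trans[OF word_equiv_sym[OF rel'[of "[j]"]] cancel[of j "[i]" "[]", simplified]] 2 two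
      by (auto simp: eval_nat_numeral)
    ultimately show ?thesis
      using eq[of "[i, j, i]"] eq[of "[j, i, j]"] eq[of "[i, j, i, j, i]"] eq[of "[j, i, j, i, j]"]
        eq[of "[i, j, i, j, i, j, i]"] eq[of "[j, i, j, i, j, i, j]"] 2 two assms(2)
      by (simp add: eval_nat_numeral conj conj2 conj3) blast?
  next
    case three
    have rel': "word_equiv n (i # j # i # w) (j # i # j # w)" if "set w \<subseteq> {0..n}" for w
      using rel[OF that] three by (simp add: eval_nat_numeral)
    have "word_equiv n [i, j, i, j, i] [j]"
      using word_equiv_trans[OF word_equiv_trans[OF rel'[of "[j, i]"] cancel[of j "[j, i]" "[i]", simplified]]
          cancel[of i "[j]" "[]", simplified]] 2 three
      by (auto simp: eval_nat_numeral)
    moreover have "word_equiv n [j, i, j, i, j] [i]"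
      using word_equiv_trans[OF word_equiv_trans[OF word_equiv_sym[OF rel'[of "[i, j]"]]
          cancel[of i "[i, j]" "[j]", simplified]] cancel[of j "[i]" "[]", simplified]] 2 three
      by (auto simp: eval_nat_numeral)
    moreover have "word_equiv n [i, j, i] [j, i, j]"
      using rel'[of "[]"] by simp
    ultimately show ?thesis
      using eq[of "[i, j, i]"] eq[of "[j, i, j]"] eq[of "[i, j, i, j, i]"] eq[of "[j, i, j, i, j]"]
        eq[of "[i, j, i, j, i, j, i]"] eq[of "[j, i, j, i, j, i, j]"] 2 three assms(2)
      by (simp add: eval_nat_numeral conj conj2 conj3) blast?
  next
    case four
    have rel': "word_equiv n (i # j # i # j # w) (j # i # j # i # w)" if "set w \<subseteq> {0..n}" for w
      using rel[OF that] four by (simp add: eval_nat_numeral)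
    have "word_equiv n [i, j, i, j, i, j, i] [j]"
      using word_equiv_trans[OF word_equiv_trans[OF word_equiv_trans[OF rel'[of "[i, j, i]"]
          cancel[of i "[j, i, j]" "[j, i]", simplified]] cancel[of j "[j, i]" "[i]", simplified]] cancel[of i "[j]" "[]", simplified]]
        2 four
      by (auto simp: eval_nat_numeral)
    moreover have "word_equiv n [j, i, j, i, j, i, j] [i]"
      using word_equiv_trans[OF word_equiv_trans[OF word_equiv_trans[OF
          word_equiv_sym[OF rel'[of "[j, i, j]"]] cancel[of j "[i, j, i]" "[i, j]", simplified]]
          cancel[of i "[i, j]" "[j]", simplified]] cancel[of j "[i]" "[]", simplified]] 2 four
      by (auto simp: eval_nat_numeral)
    moreover have "word_equiv n [i, j, i, j, i] [j, i, j]"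
      using word_equiv_trans[OF rel'[of "[i]"] cancel[of i "[j, i, j]" "[]", simplified]] 2 four
      by (auto simp: eval_nat_numeral)
    moreover have "word_equiv n [j, i, j, i, j] [i, j, i]"
      using word_equiv_trans[OF word_equiv_sym[OF rel'[of "[j]"]] cancel[of j "[i, j, i]" "[]", simplified]] 2 four
      by (auto simp: eval_nat_numeral)
    ultimately show ?thesis
      using eq[of "[i, j, i]"] eq[of "[j, i, j]"] eq[of "[i, j, i, j, i]"] eq[of "[j, i, j, i, j]"]
        eq[of "[i, j, i, j, i, j, i]"] eq[of "[j, i, j, i, j, i, j]"] 2 four assms(2)
       
      by (simp add: eval_nat_numeral conj conj2 conj3) blast?
  qed
qed

lemma reflection_parity_cong:
  assumes "word_equiv n u u'" "set v \<subseteq> {0..n}" "2 \<le> n"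
  shows "reflection_parity n u v = reflection_parity n u' v"
  using assms
proof (induction arbitrary: v)
  case (word_equiv_rel u u' a b)
  have "word_equiv n u u'"
    using word_equiv.word_equiv_rel[OF word_equiv_rel(1), of "[]" "[]"] by simp
  \<comment> \<open>The suffix \<open>b\<close> sees \<open>v\<close> only conjugated by the prefix,
    so \<open>u\<close> is exchanged for \<open>u'\<close> on both sides of that conjugate, one side
    at a time.\<close>
  then have "word_equiv n (rev u @ rev a @ v @ a @ u) (rev u' @ rev a @ v @ a @ u)"
    "word_equiv n (rev u' @ rev a @ v @ a @ u) (rev u' @ rev a @ v @ a @ u')"
    using word_equiv_words[of n u u'] word_equiv_rel
      word_equiv_append_right[OF word_equiv_rev, of n u u' "rev a @ v @ a @ u"]
      word_equiv_append_left[of n u u' "rev u' @ rev a @ v @ a"]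
    by auto
  then have "word_equiv n (rev u @ rev a @ v @ a @ u) (rev u' @ rev a @ v @ a @ u')"
    by (rule word_equiv_trans)
  from reflection_parity_cong_right[OF this, of b] show ?case
    using word_equiv_rel reflection_parity_relation[OF word_equiv_rel(1), of "rev a @ v @ a"]
    by (simp add: reflection_parity_append)
qed auto

section \<open>Deletion and exchange\<close>

definition remove_nth :: "nat \<Rightarrow> 'a list \<Rightarrow> 'a list" where
  "remove_nth k u = take k u @ drop (Suc k) u"

lemma remove_nth_0_Cons [simp]: "remove_nth 0 (i # u) = u"
  by (simp add: remove_nth_def)

lemma remove_nth_Suc_Cons [simp]: "remove_nth (Suc k) (i # u) = i # remove_nth k u"
  by (simp add: remove_nth_def)

lemma length_remove_nth: "k < length u \<Longrightarrow> Suc (length (remove_nth k u)) = length u"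
  by (simp add: remove_nth_def)

lemma set_remove_nth: "set (remove_nth k u) \<subseteq> set u"
  by (auto simp: remove_nth_def dest: in_set_takeD in_set_dropD)

lemma remove_nth_append:
  "remove_nth k (u @ v) = (if k < length u then remove_nth k u @ v else u @ remove_nth (k - length u) v)"
  by (auto simp: remove_nth_def Suc_diff_le)

text \<open>An odd count is positive, so \<open>v\<close> represents \<open>a i a^(-1)\<close> for
  some factorisation \<open>u = a i b\<close>; then \<open>v u = a i i b = a b\<close>.\<close>

lemma reflection_parity_deletion:
  assumes "reflection_parity n u v" "set u \<subseteq> {0..n}" "set v \<subseteq> {0..n}"
  shows "\<exists>k<length u. word_equiv n (v @ u) (remove_nth k u)"
  using assms
proof (induction u arbitrary: v)
  case (Cons i u)
  show ?case
  proof (cases "word_equiv n v [i]")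
    case True
    then have "word_equiv n (v @ i # u) (i # i # u)"
      using word_equiv_append_right[OF True, of "i # u"] Cons.prems by simp
    then have "word_equiv n (v @ i # u) u"
      using word_equiv_cancel_square[of i n u] Cons.prems by (simp add: word_equiv_trans)
    then show ?thesis by (intro exI[of _ 0]) simp
  next
    case False
    with Cons.prems have "reflection_parity n u (i # v @ [i])" "set (i # v @ [i]) \<subseteq> {0..n}"
      by auto
    from Cons.IH[OF this(1) _ this(2)] obtain k
      where k: "k < length u" "word_equiv n ((i # v @ [i]) @ u) (remove_nth k u)"
      using Cons.prems(2) by auto
    then have "word_equiv n (v @ i # u) (i # remove_nth k u)"
      using word_equiv_Cons_iff[of i n "v @ i # u" "remove_nth k u"] Cons.prems
        set_remove_nth[of k u] by auto
    with k show ?thesis by (intro exI[of _ "Suc k"]) simp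
  qed
qed simp

definition reduced_word :: "nat \<Rightarrow> nat list \<Rightarrow> bool" where
  "reduced_word n u \<longleftrightarrow> set u \<subseteq> {0..n} \<and> (\<forall>v. word_equiv n u v \<longrightarrow> length u \<le> length v)"

lemma reduced_word_cong:
  assumes "reduced_word n u" "word_equiv n u v" "length v = length u" "2 \<le> n"
  shows "reduced_word n v"
  using assms word_equiv_words[OF assms(2,4)] word_equiv_trans[OF assms(2)]
  by (simp add: reduced_word_def)

lemma ex_reduced_word:
  assumes "set u \<subseteq> {0..n}" "2 \<le> n"
  shows "\<exists>v. word_equiv n u v \<and> reduced_word n v"
proof -
  obtain v where v: "word_equiv n u v" "\<And>w. word_equiv n u w \<Longrightarrow> length v \<le> length w"
    using ex_has_least_nat[of "word_equiv n u" u length] word_equiv_refl[OF assms(1)] by blast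
  then show ?thesis
    using word_equiv_words[OF v(1) assms(2)] word_equiv_trans[OF v(1)]
    by (auto simp: reduced_word_def intro!: exI[of _ v])
qed

lemma reduced_word_ConsD:
  assumes "reduced_word n (i # u)"
  shows "reduced_word n u"
  unfolding reduced_word_def
proof (intro conjI allI impI)
  fix v assume "word_equiv n u v"
  then have "word_equiv n (i # u) (i # v)"
    using assms by (auto simp: reduced_word_def intro: word_equiv_Cons)
  with assms show "length u \<le> length v" by (force simp: reduced_word_def)
qed (use assms in \<open>auto simp: reduced_word_def\<close>)

text \<open>If the parity of \<open>u\<close> at the reflection \<open>i\<close> is odd, the
  deletion lemma applies. If it is even, that of \<open>i # u\<close> is odd, and so is that of a
  reduced word \<open>v\<close> of the same element. Deletion in \<open>v\<close> then represents
  \<open>i v = u\<close> by a word shorter than \<open>v\<close>; hence \<open>u\<close> is shorter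
  than \<open>v\<close> and \<open>i # u\<close> is reduced after all.\<close>

lemma exchange:
  assumes "reduced_word n u" "\<not> reduced_word n (i # u)" "i \<le> n" "2 \<le> n"
  shows "\<exists>k<length u. word_equiv n (i # u) (remove_nth k u)"
proof -
  have u: "set u \<subseteq> {0..n}" using assms by (simp add: reduced_word_def)
  have "reflection_parity n u [i]"
  proof (rule ccontr)
    assume "\<not> reflection_parity n u [i]"
    moreover have "word_equiv n [i, i, i] [i]"
      using word_equiv_cancel_square[of i n "[i]"] assms by simp
    ultimately have *: "reflection_parity n (i # u) [i]"
      using reflection_parity_cong_right[of n "[i, i, i]" "[i]" u] u assms
      by (auto intro: word_equiv_refl)
    obtain v where v: "word_equiv n (i # u) v" "reduced_word n v"
      using ex_reduced_word[of "i # u" n] u assms by auto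
    then have "reflection_parity n v [i]" "set v \<subseteq> {0..n}"
      using * reflection_parity_cong[OF v(1), of "[i]"] assms by (auto simp: reduced_word_def)
    then obtain k where k: "k < length v" "word_equiv n (i # v) (remove_nth k v)"
      using reflection_parity_deletion[of n v "[i]"] assms by auto
    moreover have "word_equiv n u (i # v)"
      using v(1) word_equiv_Cons_iff[of i n u v] u assms \<open>set v \<subseteq> {0..n}\<close> by simp
    ultimately have "word_equiv n u (remove_nth k v)"
      by (blast intro: word_equiv_trans)
    then have "length u < length v"
      using assms(1) length_remove_nth[OF k(1)] by (fastforce simp: reduced_word_def)
    then have "reduced_word n (i # u)"
      using v assms u word_equiv_trans[OF word_equiv_sym[OF v(1)]]
      by (fastforce simp: reduced_word_def)
    with assms show False by simp
  qed
  from reflection_parity_deletion[OF this u] assms show ?thesis by simp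
qed

section \<open>Braid moves and the theorems of Matsumoto and Tits\<close>

text \<open>Unlike \<open>word_equiv\<close>, this keeps the length fixed, as squares are not
  cancelled. Symmetry is no rule of its own: exchanging \<open>i\<close> and \<open>j\<close>
  reverses a move.\<close>

inductive braid_equiv :: "nat \<Rightarrow> nat list \<Rightarrow> nat list \<Rightarrow> bool" for n :: nat where
  braid_equiv_refl: "set u \<subseteq> {0..n} \<Longrightarrow> braid_equiv n u u"
| braid_equiv_trans: "braid_equiv n u v \<Longrightarrow> braid_equiv n v w \<Longrightarrow> braid_equiv n u w"
| braid_equiv_move: "i \<le> n \<Longrightarrow> j \<le> n \<Longrightarrow> i \<noteq> j \<Longrightarrow> set a \<subseteq> {0..n} \<Longrightarrow> set b \<subseteq> {0..n} \<Longrightarrow>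
    braid_equiv n (a @ alternating i j (coxeter_order n i j) @ b)
      (a @ alternating j i (coxeter_order n i j) @ b)"

lemma braid_equiv_sym: "braid_equiv n u v \<Longrightarrow> braid_equiv n v u"
proof (induction rule: braid_equiv.induct)
  case (braid_equiv_move i j a b)
  then show ?case
    using braid_equiv.braid_equiv_move[of j n i a b] by (simp add: coxeter_order_sym)
qed (blast intro: braid_equiv.intros)+

lemma braid_equiv_Cons: "braid_equiv n u v \<Longrightarrow> i \<le> n \<Longrightarrow> braid_equiv n (i # u) (i # v)"
proof (induction rule: braid_equiv.induct)
  case (braid_equiv_refl u)
  then show ?case by (intro braid_equiv.braid_equiv_refl) auto
next
  case (braid_equiv_move j k a b)
  then show ?case
    using braid_equiv.braid_equiv_move[of j n k "i # a" b] by simp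
qed (blast intro: braid_equiv_trans)

lemma remove_nth_alternating: "remove_nth k (alternating i j (Suc k)) = alternating i j k"
proof (induction k arbitrary: i j)
  case (Suc k)
  from Suc[of j i] show ?case by simp
qed simp

text \<open>An element with reduced words starting in \<open>i\<close> and in \<open>j\<close> has
  one starting with an alternating word of any length up to \<open>m_ij\<close>. By induction with
  \<open>i\<close> and \<open>j\<close> exchanged, it has the reduced word \<open>?a @ z\<close>
  with \<open>?a\<close> alternating from \<open>j\<close>. Since \<open>i\<close> shortens the
  element, a letter of this word can be traded for an \<open>i\<close> in front. A letter of
  \<open>z\<close> gives the longer alternating prefix; a letter of \<open>?a\<close> leads to a
  contradiction.\<close>

lemma reduced_word_alternating:
  assumes "reduced_word n (i # u)" "word_equiv n (i # u) (j # v)" "length v = length u"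
    and "i \<noteq> j" "2 \<le> n" "k \<le> coxeter_order n i j" "0 < k"
  shows "\<exists>z. word_equiv n (i # u) (alternating i j k @ z) \<and> k + length z = Suc (length u)"
  using assms
proof (induction k arbitrary: i j u v)
  case (Suc k)
  have ij: "i \<le> n" "j \<le> n" and uv: "set u \<subseteq> {0..n}" "set v \<subseteq> {0..n}"
    using word_equiv_words[OF Suc.prems(2,5)] by auto
  show ?case
  proof (cases "k = 0")
    case True
    then show ?thesis using uv ij by (intro exI[of _ u]) (simp add: word_equiv_refl)
  next
    case False
    have red: "reduced_word n (j # v)"
      using reduced_word_cong[OF Suc.prems(1,2)] Suc.prems by simp
    obtain z where z: "word_equiv n (j # v) (alternating j i k @ z)" "k + length z = Suc (length v)"
      using Suc.IH[OF red word_equiv_sym[OF Suc.prems(2)]] Suc.prems False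
      by (auto simp: coxeter_order_sym)
    let ?a = "alternating j i k"
    have az: "set (?a @ z) \<subseteq> {0..n}" using word_equiv_words[OF z(1) Suc.prems(5)] by simp
    have iaz: "word_equiv n (i # u) (?a @ z)"
      using Suc.prems(2) z(1) by (rule word_equiv_trans)
    have redaz: "reduced_word n (?a @ z)"
      using reduced_word_cong[OF red z(1)] z(2) Suc.prems(5) by simp
    have uaz: "word_equiv n (i # ?a @ z) u"
      using word_equiv_Cons_iff[of i n u "?a @ z"] iaz az uv ij
        word_equiv_sym[of n u "i # ?a @ z"] by simp
    have "\<not> reduced_word n (i # ?a @ z)"
      using uaz z(2) Suc.prems(3) by (auto simp: reduced_word_def)
    with exchange[OF redaz this ij(1) Suc.prems(5)] obtain p
      where p: "p < length (?a @ z)" "word_equiv n (i # ?a @ z) (remove_nth p (?a @ z))" by blast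
    have p': "word_equiv n (?a @ z) (i # remove_nth p (?a @ z))"
      using p(2) az ij word_equiv_Cons_iff[of i n "?a @ z" "remove_nth p (?a @ z)"]
        set_remove_nth[of p "?a @ z"] by auto
    show ?thesis
    proof (cases "p < k")
      case False
      then have "word_equiv n (i # u) (alternating i j (Suc k) @ remove_nth (p - k) z)"
        using word_equiv_trans[OF iaz p'] by (simp add: remove_nth_append)
      moreover have "Suc (length (remove_nth (p - k) z)) = length z"
        using p(1) False by (intro length_remove_nth) auto
      ultimately show ?thesis using z(2) Suc.prems(3) by force
    next
      case True
      let ?r = "remove_nth p ?a"
      have r: "set ?r \<subseteq> {0..n}" using set_remove_nth[of p ?a] az by auto
      have eq: "word_equiv n (?a @ z) (i # ?r @ z)"
        using p' True by (simp add: remove_nth_append)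
      then have eq': "word_equiv n ?a (i # ?r)"
        using word_equiv_append_right_cancel[of n ?a z "i # ?r"] az r ij by auto
      have noshort: False if "word_equiv n (i # ?r) b" "length b < k" for b
      proof -
        have "word_equiv n (?a @ z) (b @ z)"
          using word_equiv_append_right[OF word_equiv_trans[OF eq' that(1)], of z] az by simp
        then show False using redaz that(2) by (force simp: reduced_word_def)
      qed
      \<comment> \<open>Deleting the last letter of \<open>?a\<close> would equate two alternating
        words of length below \<open>m_ij\<close>. Any other deletion puts two equal letters side by
        side in \<open>i # ?r\<close>, which therefore shortens, against
        \<open>noshort\<close>.\<close>
      have "k < 4" using Suc.prems(6) by (auto simp: coxeter_order_def split: if_splits)
      with True consider "k = Suc p" | "k = 2" "p = 0" | "k = 3" "p = 0" | "k = 3" "p = 1"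
        by linarith
      then have False
      proof cases
        case 1
        then have "?r = alternating j i p"
          using 1 by (simp only: remove_nth_alternating)
        then have "word_equiv n ?a (alternating i j k)"
          using eq' 1 by simp
        then show False
          using not_word_equiv_alternating[of j n i k] ij Suc.prems(4-6) True coxeter_order_sym[of n i j]
          by auto
      next
        case 2
        then show False using noshort[of "[]"] word_equiv_square[OF ij(1)] by (simp add: eval_nat_numeral)
      next
        case 3
        then show False using noshort[of "[j]"] word_equiv_cancel_square[OF ij(1), of "[j]"] ij
          by (simp add: eval_nat_numeral)
      next
        case 4
        then show False using noshort[of "[i]"] word_equiv_Cons[OF word_equiv_square[OF ij(2)] ij(1)]
          by (simp add: eval_nat_numeral)
      qed
      then show ?thesis ..
    qed
  qed
qed simp

text \<open>Induction on the length. Equal first letters are cancelled. For first letters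
  \<open>i \<noteq> j\<close> the element has the reduced words \<open>alternating i j m @ z\<close>
  and \<open>alternating j i m @ z\<close>, which differ by one braid move; the first shares its
  first letter with \<open>u\<close>, the second with \<open>v\<close>.\<close>

theorem reduced_words_braid_equiv:
  assumes "reduced_word n u" "word_equiv n u v" "length v = length u" "2 \<le> n"
  shows "braid_equiv n u v"
  using assms
proof (induction "length u" arbitrary: u v)
  case 0
  then show ?case by (simp add: braid_equiv_refl)
next
  case (Suc l)
  obtain i u' where u: "u = i # u'" using Suc.hyps(2) by (cases u) auto
  obtain j v' where v: "v = j # v'" using Suc.hyps(2) Suc.prems(3) by (cases v) auto
  have same: "braid_equiv n (k # a) (k # b)"
    if "reduced_word n (k # a)" "word_equiv n (k # a) (k # b)" "length b = length a" "length a = l"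
    for k a b
  proof -
    have w: "k \<le> n" "set a \<subseteq> {0..n}" "set b \<subseteq> {0..n}"
      using word_equiv_words[OF that(2) \<open>2 \<le> n\<close>] by auto
    then have "word_equiv n a (k # k # b)"
      using that(2) word_equiv_Cons_iff[of k n a "k # b"] by simp
    from word_equiv_trans[OF this word_equiv_cancel_square] w have "word_equiv n a b"
      by simp
    from Suc.hyps(1)[OF that(4)[symmetric] reduced_word_ConsD[OF that(1)] this that(3) \<open>2 \<le> n\<close>] w
    show ?thesis by (intro braid_equiv_Cons)
  qed
  show ?case
  proof (cases "i = j")
    case True
    from Suc.prems(1,2) have "braid_equiv n (i # u') (i # v')"
      unfolding u v True using Suc.hyps(2) Suc.prems(3) u v by (intro same) simp_all
    with True u v show ?thesis by simp
  next
    case False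
    define m where "m = coxeter_order n i j"
    have "m \<noteq> 0" by (simp add: m_def coxeter_order_def)
    then obtain m' where m': "m = Suc m'" "0 < m" by (cases m) auto
    have ij: "i \<le> n" "j \<le> n" using word_equiv_words[OF Suc.prems(2,4)] u v by auto
    obtain z where z: "word_equiv n u (alternating i j m @ z)" "m + length z = length u"
      using reduced_word_alternating[of n i u' j v' m] Suc.prems False m'(2)
      unfolding u v m_def[symmetric] by (simp add: m_def) blast?
    have zw: "set z \<subseteq> {0..n}" using word_equiv_words[OF z(1) Suc.prems(4)] by simp
    have b: "braid_equiv n (alternating i j m @ z) (alternating j i m @ z)"
      using braid_equiv_move[of i n j "[]" z] ij False zw by (simp add: m_def)
    have "word_equiv n (alternating i j m @ z) (alternating j i m @ z)"
      using word_equiv_append_right[OF word_equiv_alternating[of i n j]] ij False zw Suc.prems(4)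
      by (simp add: m_def)
    then have z': "word_equiv n v (alternating j i m @ z)"
      using word_equiv_trans[OF word_equiv_sym[OF Suc.prems(2)] word_equiv_trans[OF z(1)]] by blast
    have "braid_equiv n u (alternating i j m @ z)"
      using same[of i u' "alternating j i m' @ z"] z u m' Suc.hyps(2) Suc.prems(1) by simp
    moreover have "braid_equiv n v (alternating j i m @ z)"
      using same[of j v' "alternating i j m' @ z"] z z' v m' Suc.hyps(2) Suc.prems(3)
        reduced_word_cong[OF Suc.prems] by simp
    ultimately show ?thesis
      using b by (metis braid_equiv_trans braid_equiv_sym)
  qed
qed

text \<open>Consider a non-reduced suffix \<open>i # u\<close> with \<open>u\<close> reduced.
  Exchange shows that \<open>u\<close> and \<open>i # remove_nth k u\<close> are words of the same
  element and of the same length, hence braid equivalent, and putting \<open>i\<close> in front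
  produces the square.\<close>

theorem nonreduced_word_braid_equiv:
  assumes "\<not> reduced_word n u" "set u \<subseteq> {0..n}" "2 \<le> n"
  shows "\<exists>a i b. i \<le> n \<and> set a \<subseteq> {0..n} \<and> set b \<subseteq> {0..n} \<and> Suc (Suc (length a + length b)) = length u
    \<and> braid_equiv n u (a @ i # i # b)"
  using assms
proof (induction u)
  case Nil
  then show ?case by (simp add: reduced_word_def)
next
  case (Cons i u)
  then have i: "i \<le> n" and u: "set u \<subseteq> {0..n}" by auto
  show ?case
  proof (cases "reduced_word n u")
    case True
    from exchange[OF True Cons.prems(1) i \<open>2 \<le> n\<close>] obtain k
      where k: "k < length u" "word_equiv n (i # u) (remove_nth k u)" by blast
    have w: "set (remove_nth k u) \<subseteq> {0..n}" using u set_remove_nth[of k u] by auto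
    have "word_equiv n u (i # remove_nth k u)"
      using k(2) word_equiv_Cons_iff[OF i u w] by simp
    then have "braid_equiv n u (i # remove_nth k u)"
      using True k(1) length_remove_nth[of k u] \<open>2 \<le> n\<close> by (intro reduced_words_braid_equiv) auto
    from braid_equiv_Cons[OF this i] show ?thesis
      using i w k(1) length_remove_nth[of k u]
      by (intro exI[of _ "[]"] exI[of _ i] exI[of _ "remove_nth k u"]) auto
  next
    case False
    with Cons u obtain a j b where "j \<le> n" "set a \<subseteq> {0..n}" "set b \<subseteq> {0..n}"
      "Suc (Suc (length a + length b)) = length u" "braid_equiv n u (a @ j # j # b)" by blast
    with i braid_equiv_Cons[of n u "a @ j # j # b" i] show ?thesis
      by (intro exI[of _ "i # a"] exI[of _ j] exI[of _ b]) auto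
  qed
qed

section \<open>Polynomials\<close>

text \<open>The ring is not commutative; commutation between the two families of factors is what
  reordering takes. It makes monomials multiply by adding exponents.\<close>

lemma prod_list_mult_commuting:
  fixes f g :: "'b \<Rightarrow> 'a::ring_1"
  assumes "\<And>i j. i \<in> set l \<Longrightarrow> j \<in> set l \<Longrightarrow> g i * f j = f j * g i"
  shows "(\<Prod>i\<leftarrow>l. f i * g i) = (\<Prod>i\<leftarrow>l. f i) * (\<Prod>i\<leftarrow>l. g i)"
  using assms
proof (induction l)
  case (Cons k l)
  note comm = Cons.prems
  have "g k * (\<Prod>i\<leftarrow>m. f i) = (\<Prod>i\<leftarrow>m. f i) * g k" if "set m \<subseteq> set l" for m
    using that
  proof (induction m)
    case (Cons i m)
    have "g k * f i = f i * g k" using Cons.prems comm[of k i] by simp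
    then have "g k * (f i * (\<Prod>i\<leftarrow>m. f i)) = f i * (g k * (\<Prod>i\<leftarrow>m. f i))"
      by (simp add: mult.assoc[symmetric])
    with Cons show ?case by (simp add: mult.assoc)
  qed simp
  from this[of l] have "g k * ((\<Prod>i\<leftarrow>l. f i) * (\<Prod>i\<leftarrow>l. g i)) = (\<Prod>i\<leftarrow>l. f i) * (g k * (\<Prod>i\<leftarrow>l. g i))"
    by (simp add: mult.assoc[symmetric])
  with Cons show ?case by (simp add: mult.assoc)
qed simp

lemma Const_0 [simp]: "Const 0 = 0"
  by (simp add: Const_def)

lemma Const_1 [simp]: "Const 1 = 1"
  by (simp add: Const_def)

lemma Const_add: "Const (a + b) = Const a + Const b"
  by (simp add: Const_def single_add)

lemma Const_mult: "Const (a * b) = Const a * Const b"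
  by (simp add: Const_def mult_single)

lemma Const_uminus: "Const (- a) = - Const a"
  by (simp add: Const_def single_uminus)

lemma Const_eq_0_iff [simp]: "Const c = 0 \<longleftrightarrow> c = 0"
  by (metis Const_0 Const_def lookup_single_eq)

lemma polys_add: "p \<in> polys n \<Longrightarrow> q \<in> polys n \<Longrightarrow> p + q \<in> polys n"
  unfolding polys_def using Poly_Mapping.keys_add[of p q] by blast

lemma polys_mult: "p \<in> polys n \<Longrightarrow> q \<in> polys n \<Longrightarrow> p * q \<in> polys n"
  unfolding polys_def
proof safe
  fix m i
  assume *: "\<forall>m\<in>Poly_Mapping.keys p. Poly_Mapping.keys m \<subseteq> {1..n}"
    "\<forall>m\<in>Poly_Mapping.keys q. Poly_Mapping.keys m \<subseteq> {1..n}"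
    and "m \<in> Poly_Mapping.keys (p * q)" and i: "i \<in> Poly_Mapping.keys m"
  then obtain a b where "a \<in> Poly_Mapping.keys p" "b \<in> Poly_Mapping.keys q" "m = a + b"
    using Poly_Mapping.keys_mult[of p q] by blast
  with * i show "i \<in> {1..n}" using Poly_Mapping.keys_add[of a b] by blast
qed

lemma polys_Const [simp]: "Const c \<in> polys n"
  by (simp add: polys_def Const_def)

lemma polys_0 [simp]: "0 \<in> polys n"
  by (simp add: polys_def)

lemma polys_1 [simp]: "1 \<in> polys n"
  by (simp add: polys_def)

lemma polys_Var [simp]: "i \<in> {1..n} \<Longrightarrow> Var i \<in> polys n"
  by (simp add: polys_def Var_def)

lemma polys_uminus: "p \<in> polys n \<Longrightarrow> - p \<in> polys n"
  using polys_mult[OF polys_Const[of "-1" n], of p] by (simp add: Const_uminus)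

lemma polys_diff: "p \<in> polys n \<Longrightarrow> q \<in> polys n \<Longrightarrow> p - q \<in> polys n"
  using polys_add[of p n "- q"] polys_uminus[of q n] by simp

lemma poly_mapping_sum_single:
  "p = (\<Sum>k\<in>Poly_Mapping.keys p. Poly_Mapping.single k (Poly_Mapping.lookup p k))"
proof (rule poly_mapping_eqI)
  fix k
  show "Poly_Mapping.lookup p k
    = Poly_Mapping.lookup (\<Sum>k\<in>Poly_Mapping.keys p. Poly_Mapping.single k (Poly_Mapping.lookup p k)) k"
    by (simp add: lookup_sum lookup_single when_def in_keys_iff)
qed

text \<open>The polynomials in \<open>x_1, ..., x_n\<close> are generated as a ring by the constants
  and the variables, so properties of ring homomorphisms and the cross relations need checking on
  variables only.\<close>

lemma polys_induct [consumes 1, case_names Const Var add mult]: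
  assumes "p \<in> polys n"
    and Const: "\<And>c. P (Const c)"
    and Var: "\<And>i. i \<in> {1..n} \<Longrightarrow> P (Var i)"
    and add: "\<And>p q. p \<in> polys n \<Longrightarrow> q \<in> polys n \<Longrightarrow> P p \<Longrightarrow> P q \<Longrightarrow> P (p + q)"
    and mult: "\<And>p q. p \<in> polys n \<Longrightarrow> q \<in> polys n \<Longrightarrow> P p \<Longrightarrow> P q \<Longrightarrow> P (p * q)"
  shows "P p"
proof -
  \<comment> \<open>Membership in \<open>polys n\<close> is carried along because the rules for sums
    and products presuppose it.\<close>
  define Q where "Q p \<longleftrightarrow> p \<in> polys n \<and> P p" for p
  have Qsum: "Q (\<Sum>k\<in>S. f k)" if "\<And>k. k \<in> S \<Longrightarrow> Q (f k)" for f :: "_ \<Rightarrow> mpoly" and S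
    using that Const[of 0]
    by (induction S rule: infinite_finite_induct) (auto simp: Q_def intro: polys_add add)
  have Qprod: "Q (\<Prod>k\<in>S. f k)" if "\<And>k. k \<in> S \<Longrightarrow> Q (f k)" for f :: "nat \<Rightarrow> mpoly" and S
    using that Const[of 1]
    by (induction S rule: infinite_finite_induct) (auto simp: Q_def intro: polys_mult mult)
  have Qpow: "Q (p ^ k)" if "Q p" for p k
    using that Const[of 1] by (induction k) (auto simp: Q_def intro: polys_mult mult)
  have mon: "Poly_Mapping.single m 1 = (\<Prod>i\<in>Poly_Mapping.keys m. Var i ^ Poly_Mapping.lookup m i)"
    for m :: "nat \<Rightarrow>\<^sub>0 nat"
  proof -
    have pow: "Var i ^ k = Poly_Mapping.single (Poly_Mapping.single i k) 1" for i k
      by (induction k) (simp_all add: Var_def mult_single single_add[symmetric])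
    have "(\<Prod>i\<in>S. Poly_Mapping.single (f i) (1::complex)) = Poly_Mapping.single (\<Sum>i\<in>S. f i) 1"
      if "finite S" for f :: "nat \<Rightarrow> nat \<Rightarrow>\<^sub>0 nat" and S
      using that by (induction S rule: finite_induct) (simp_all add: mult_single)
    then show ?thesis
      using poly_mapping_sum_single[of m] by (simp add: pow)
  qed
  have "Q (Poly_Mapping.single m c)" if "Poly_Mapping.keys m \<subseteq> {1..n}" for m c
  proof -
    have "Poly_Mapping.single m c = Const c * Poly_Mapping.single m 1"
      by (simp add: Const_def mult_single)
    moreover have "Q (Poly_Mapping.single m 1)"
      unfolding mon using that Var by (intro Qprod Qpow) (auto simp: Q_def)
    ultimately show ?thesis using Const mult by (auto simp: Q_def intro: polys_mult)
  qed
  then have "Q p"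
    using assms(1) by (subst poly_mapping_sum_single[of p]) (intro Qsum, auto simp: polys_def)
  then show ?thesis by (simp add: Q_def)
qed

text \<open>Evaluation is a homomorphism on all polynomials: the variables outside \<open>1, \<dots>, n\<close> are
  sent to \<open>1\<close>.\<close>

locale poly_evaluation =
  fixes n :: nat and \<iota> :: "complex \<Rightarrow> 'b::ring_1" and y :: "nat \<Rightarrow> 'b"
  assumes scalar_add: "\<iota> (a + b) = \<iota> a + \<iota> b"
    and scalar_mult: "\<iota> (a * b) = \<iota> a * \<iota> b"
    and scalar_one: "\<iota> 1 = 1"
    and scalar_central: "\<iota> a * z = z * \<iota> a"
    and commute: "i \<in> {1..n} \<Longrightarrow> j \<in> {1..n} \<Longrightarrow> y i * y j = y j * y i"
begin

lemma scalar_zero: "\<iota> 0 = 0"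
  using scalar_add[of 0 0] by simp

definition monomial_value :: "(nat \<Rightarrow>\<^sub>0 nat) \<Rightarrow> 'b" where
  "monomial_value m = (\<Prod>j\<leftarrow>[1..<n + 1]. y j ^ Poly_Mapping.lookup m j)"

lemma value_superset:
  assumes "finite S" "Poly_Mapping.keys p \<subseteq> S"
  shows "poly_value n \<iota> y p = (\<Sum>m\<in>S. \<iota> (Poly_Mapping.lookup p m) * monomial_value m)"
  unfolding poly_value_def monomial_value_def using assms
  by (intro sum.mono_neutral_left) (auto simp: in_keys_iff scalar_zero)

lemma value_add: "poly_value n \<iota> y (p + q) = poly_value n \<iota> y p + poly_value n \<iota> y q"
proof -
  let ?S = "Poly_Mapping.keys p \<union> Poly_Mapping.keys q"
  show ?thesis
    using Poly_Mapping.keys_add[of p q]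
    by (simp add: value_superset[of ?S] lookup_add scalar_add distrib_right sum.distrib)
qed

lemma value_zero: "poly_value n \<iota> y 0 = 0"
  by (simp add: poly_value_def)

lemma value_sum: "poly_value n \<iota> y (\<Sum>k\<in>S. f k) = (\<Sum>k\<in>S. poly_value n \<iota> y (f k))"
  by (induction S rule: infinite_finite_induct) (simp_all add: value_add value_zero)

lemma value_single: "poly_value n \<iota> y (Poly_Mapping.single m c) = \<iota> c * monomial_value m"
  by (subst value_superset[of "{m}"]) (auto simp: scalar_zero)

lemma power_commute: "i \<in> {1..n} \<Longrightarrow> j \<in> {1..n} \<Longrightarrow> y i ^ a * y j ^ b = y j ^ b * y i ^ a"
  by (intro power_commuting_commutes power_commuting_commutes[symmetric] commute)

lemma monomial_value_add: "monomial_value (m + m') = monomial_value m * monomial_value m'"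
  unfolding monomial_value_def
  by (subst prod_list_mult_commuting[symmetric])
    (auto simp: lookup_add power_add intro!: power_commute)

lemma monomial_value_0: "monomial_value 0 = 1"
  by (simp add: monomial_value_def map_replicate_const)

lemma value_mult: "poly_value n \<iota> y (p * q) = poly_value n \<iota> y p * poly_value n \<iota> y q"
proof -
  have single: "poly_value n \<iota> y (Poly_Mapping.single m c * Poly_Mapping.single m' c')
    = poly_value n \<iota> y (Poly_Mapping.single m c) * poly_value n \<iota> y (Poly_Mapping.single m' c')"
    for m m' c c'
    by (simp add: mult_single value_single scalar_mult monomial_value_add mult.assoc)
      (metis mult.assoc scalar_central)
  show ?thesis
    by (subst (1 2) poly_mapping_sum_single[of p], subst (1 2) poly_mapping_sum_single[of q])
      (simp only: sum_product value_sum single)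
qed

lemma value_Const: "poly_value n \<iota> y (Const c) = \<iota> c"
  by (simp add: Const_def value_single monomial_value_0)

lemma value_one: "poly_value n \<iota> y 1 = 1"
  using value_Const[of 1] scalar_one by simp

lemma value_uminus: "poly_value n \<iota> y (- p) = - poly_value n \<iota> y p"
  using value_add[of p "- p"] value_zero by (simp add: eq_neg_iff_add_eq_0 add.commute)

lemma value_diff: "poly_value n \<iota> y (p - q) = poly_value n \<iota> y p - poly_value n \<iota> y q"
  using value_add[of p "- q"] value_uminus by simp

lemma value_Var:
  assumes "i \<in> {1..n}"
  shows "poly_value n \<iota> y (Var i) = y i"
proof -
  have "(\<Prod>j\<leftarrow>l. y j ^ Poly_Mapping.lookup (Poly_Mapping.single i 1) j) = (if i \<in> set l then y i else 1)"
    if "distinct l" for l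
    using that by (induction l) (auto simp: lookup_single when_def)
  from this[of "[1..<n + 1]"] assms show ?thesis
    by (simp add: Var_def value_single scalar_one monomial_value_def del: upt_Suc)
qed

end

section \<open>The reflections as ring automorphisms of the polynomials\<close>

interpretation refl_poly: poly_evaluation n Const "refl_point n i Var" for n i
  by unfold_locales (simp_all add: Const_add Const_mult mult.commute)

lemma refl_poly_Const [simp]: "refl_poly n i (Const c) = Const c"
  by (simp add: refl_poly_def refl_poly.value_Const)

lemma refl_poly_Var: "j \<in> {1..n} \<Longrightarrow> refl_poly n i (Var j) = refl_point n i Var j"
  by (simp add: refl_poly_def refl_poly.value_Var)

lemma refl_poly_add [simp]: "refl_poly n i (p + q) = refl_poly n i p + refl_poly n i q"
  by (simp add: refl_poly_def refl_poly.value_add)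

lemma refl_poly_diff [simp]: "refl_poly n i (p - q) = refl_poly n i p - refl_poly n i q"
  by (simp add: refl_poly_def refl_poly.value_diff)

lemma refl_poly_uminus [simp]: "refl_poly n i (- p) = - refl_poly n i p"
  by (simp add: refl_poly_def refl_poly.value_uminus)

lemma refl_poly_mult [simp]: "refl_poly n i (p * q) = refl_poly n i p * refl_poly n i q"
  by (simp add: refl_poly_def refl_poly.value_mult)

lemma refl_poly_0 [simp]: "refl_poly n i 0 = 0"
  by (simp add: refl_poly_def refl_poly.value_zero)

lemma refl_poly_1 [simp]: "refl_poly n i 1 = 1"
  by (simp add: refl_poly_def refl_poly.value_one)

lemma refl_poly_in_polys:
  assumes "p \<in> polys n" "i \<le> n" "2 \<le> n"
  shows "refl_poly n i p \<in> polys n"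
  using assms
proof (induction rule: polys_induct)
  case (Var j)
  then show ?case
    by (auto simp: refl_poly_Var refl_point_def intro!: polys_diff polys_uminus polys_Var)
qed (auto intro: polys_add polys_mult)

lemma refl_poly_involution:
  assumes "p \<in> polys n" "i \<le> n" "2 \<le> n"
  shows "refl_poly n i (refl_poly n i p) = p"
  using assms
proof (induction rule: polys_induct)
  case (Var j)
  then show ?case
    by (auto simp: refl_poly_Var refl_point_def)
qed auto

lemma refl_poly_eq_0_iff:
  assumes "p \<in> polys n" "i \<le> n" "2 \<le> n"
  shows "refl_poly n i p = 0 \<longleftrightarrow> p = 0"
  using refl_poly_involution[OF assms] by (metis refl_poly_0)

section \<open>The algebra\<close>

text \<open>Applied with \<open>P = 2 (T\<^sub>i - t\<^sub>i)\<close> for \<open>i \<in> {0, n}\<close> and \<open>s\<close> the neighbouring generator: the braid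
  relation of length four only holds up to terms of length two.\<close>

lemma four_braid_identity:
  fixes x y r s \<tau> :: "'a::ring_1"
  assumes rr: "r * r = 1" and ss: "s * s = 1" and rs: "r * s * r * s = s * r * s * r"
    and xy: "y * x = x * y" and ry: "r * y = y * r" and sx: "s * x = y * s + \<tau>"
    and central: "\<And>z. z * \<tau> = \<tau> * z"
  defines "P \<equiv> x * (r - 1)"
  shows "P * s * P * s - s * P * s * P = \<tau> * (s * P - P * s) + \<tau> * (s * P - P * s)"
proof -
  \<comment> \<open>Conjugation of \<open>sx\<close> by \<open>s\<close>. Together the two rules
    show that \<open>s\<close> commutes with \<open>x * y\<close>.\<close>
  have sy: "s * y = x * s - \<tau>"
  proof -
    have "s * y = s * (y * s) * s" using ss by (simp add: mult.assoc)
    also have "y * s = s * x - \<tau>" using sx by simp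
    also have "s * (s * x - \<tau>) * s = (s * s) * x * s - s * (\<tau> * s)"
      by (simp add: right_diff_distrib left_diff_distrib mult.assoc)
    also have "s * (\<tau> * s) = \<tau> * (s * s)"
      by (simp add: mult.assoc[symmetric] central)
    finally show ?thesis using ss by simp
  qed
  have rr': "r * (r * z) = z" and ss': "s * (s * z) = z" and ry': "r * (y * z) = y * (r * z)"
    and rs': "r * (s * (r * s)) = s * (r * (s * r))"
    and rs'': "r * (s * (r * (s * z))) = s * (r * (s * (r * z)))"
    and xy': "y * (x * z) = x * (y * z)"
    and sx': "s * (x * z) = y * (s * z) + \<tau> * z" and sy': "s * (y * z) = x * (s * z) - \<tau> * z" for z
    using rr ss ry rs xy sx sy by (simp_all add: mult.assoc[symmetric] distrib_right left_diff_distrib)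
  have c: "x * \<tau> = \<tau> * x" "y * \<tau> = \<tau> * y" "r * \<tau> = \<tau> * r" "s * \<tau> = \<tau> * s"
    and c': "x * (\<tau> * z) = \<tau> * (x * z)" "y * (\<tau> * z) = \<tau> * (y * z)"
      "r * (\<tau> * z) = \<tau> * (r * z)" "s * (\<tau> * z) = \<tau> * (s * z)" for z
    using central by (simp_all add: mult.assoc[symmetric])
  \<comment> \<open>Moving \<open>x\<close> and \<open>y\<close> to the left leaves the correction
    \<open>\<tau> * x * (r - 1) * (r - 1) * s\<close>. As
    \<open>(r - 1) * (r - 1) = - 2 (r - 1)\<close>, it equals
    \<open>- 2 \<tau> * P * s\<close>.\<close>
  have PQ: "P * s * P * s = x * y * (r - 1) * s * (r - 1) * s - \<tau> * P * s - \<tau> * P * s"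
    unfolding P_def
    by (simp add: distrib_left distrib_right left_diff_distrib right_diff_distrib mult.assoc
        rr ss ry sx sy rr' ss' ry' sx' sy' c c')
  have QP: "s * P * s * P = x * y * s * (r - 1) * s * (r - 1) - \<tau> * s * P - \<tau> * s * P"
    unfolding P_def
    by (simp add: distrib_left distrib_right left_diff_distrib right_diff_distrib mult.assoc
        rr ss ry sx sy xy rr' ss' ry' sx' sy' xy' c c')
  \<comment> \<open>By \<open>ss\<close> the left side is \<open>r s r s - r - s r s + 1\<close>,
    the right side \<open>s r s r - s r s - r + 1\<close>.\<close>
  have "(r - 1) * s * (r - 1) * s = s * (r - 1) * s * (r - 1)"
    by (simp add: left_diff_distrib right_diff_distrib mult.assoc rs' rr ss ss')
  then have "x * y * (r - 1) * s * (r - 1) * s = x * y * s * (r - 1) * s * (r - 1)"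
    by (simp add: mult.assoc)
  then show ?thesis
    unfolding PQ QP by (simp add: right_diff_distrib mult.assoc)
qed

text \<open>In \<open>(r - 1) * x * (r - 1)\<close> all terms containing \<open>x\<close> cancel,
  leaving a central multiple of \<open>r - 1\<close>. Here \<open>x * (r - 1)\<close> will be
  \<open>2 (T_i - t_i)\<close> for an end generator.\<close>

lemma quadratic_identity:
  fixes x r c \<kappa> :: "'a::ring_1"
  assumes rr: "r * r = 1" and rx: "r * x = c * r + c * r - x * r - \<kappa>"
    and central: "\<And>z. z * \<kappa> = \<kappa> * z" "\<And>z. z * c = c * z"
  shows "(x * (r - 1)) * (x * (r - 1)) = - ((c + c + \<kappa>) * (x * (r - 1)))"
proof -
  have rr': "r * (r * z) = z" for z using rr by (simp add: mult.assoc[symmetric])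
  have "(r - 1) * x * (r - 1) = - ((c + c + \<kappa>) * (r - 1))"
    by (simp add: left_diff_distrib right_diff_distrib distrib_right distrib_left mult.assoc rr rr' rx
        algebra_simps)
  then have "x * ((r - 1) * x * (r - 1)) = - (x * ((c + c + \<kappa>) * (r - 1)))" by simp
  also have "x * ((c + c + \<kappa>) * (r - 1)) = (c + c + \<kappa>) * (x * (r - 1))"
    using central[of x] by (simp add: mult.assoc[symmetric] distrib_left distrib_right)
  finally show ?thesis by (simp add: mult.assoc)
qed

section \<open>Word classes as group elements\<close>

lemma word_class_eq_iff:
  assumes "set u \<subseteq> {0..n}"
  shows "word_class n u = word_class n v \<longleftrightarrow> word_equiv n u v"
proof
  assume "word_class n u = word_class n v"
  moreover have "u \<in> word_class n u" using assms by (simp add: word_class_def word_equiv_refl)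
  ultimately show "word_equiv n u v" by (simp add: word_class_def word_equiv_sym)
next
  assume "word_equiv n u v"
  then show "word_class n u = word_class n v"
    unfolding word_class_def by (intro Collect_cong) (metis word_equiv_sym word_equiv_trans)
qed

lemma word_class_in_carrier: "set u \<subseteq> {0..n} \<Longrightarrow> word_class n u \<in> carrier (affine_weyl n)"
  by (auto simp: affine_weyl_def)

lemma word_class_mult:
  assumes "set u \<subseteq> {0..n}" "set v \<subseteq> {0..n}" "2 \<le> n"
  shows "word_class n u \<otimes>\<^bsub>affine_weyl n\<^esub> word_class n v = word_class n (u @ v)"
proof -
  have "word_class n (u' @ v') = word_class n (u @ v)"
    if "u' \<in> word_class n u" "v' \<in> word_class n v" for u' v'
  proof -
    from that have *: "word_equiv n u u'" "word_equiv n v v'" by (simp_all add: word_class_def)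
    then have "word_equiv n (u @ v) (u' @ v')"
      using word_equiv_trans[OF word_equiv_append_right[of n u u' v] word_equiv_append_left[of n v v' u']]
        word_equiv_words[OF *(1)] assms by simp
    then show ?thesis using word_class_eq_iff[of "u @ v" n "u' @ v'"] assms by simp
  qed
  moreover have "u \<in> word_class n u" "v \<in> word_class n v"
    using assms by (simp_all add: word_class_def word_equiv_refl)
  ultimately have "(\<Union>u'\<in>word_class n u. \<Union>v'\<in>word_class n v. word_class n (u' @ v')) = word_class n (u @ v)"
    by blast
  then show ?thesis by (simp add: affine_weyl_def)
qed

lemma reduced_expressionD:
  assumes "reduced_expression w v" "w \<in> carrier (affine_weyl n)" "2 \<le> n"
  shows "w = word_class n v" "reduced_word n v"
proof -
  from assms obtain u where u: "set u \<subseteq> {0..n}" "w = word_class n u" "word_equiv n u v"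
    by (auto simp: affine_weyl_def reduced_expression_def word_class_def)
  then show w: "w = word_class n v" using word_class_eq_iff by blast
  show "reduced_word n v"
    using assms(1) word_equiv_words[OF u(3) \<open>2 \<le> n\<close>]
    unfolding reduced_word_def reduced_expression_def w word_class_def by auto
qed

lemma coroot_in_polys: "i \<in> {0, n} \<Longrightarrow> 2 \<le> n \<Longrightarrow> coroot n i \<in> polys n"
  by (auto simp: coroot_def intro!: polys_diff)

lemma Const_add_coroot_nonzero:
  assumes "i \<in> {0, n}" "2 \<le> n"
  shows "Const c + coroot n i \<noteq> 0"
proof
  assume eq: "Const c + coroot n i = 0"
  \<comment> \<open>The point is chosen so that the polynomial takes the value 1 there.\<close>
  define y where "y = (\<lambda>j::nat. if i = 0 then c - 1 / 2 else 1 - c)"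
  interpret poly_evaluation n "\<lambda>c. c" y by unfold_locales auto
  have "poly_value n (\<lambda>c. c) y (Const c + coroot n i) = c + (if i = 0 then 1 / 2 - y 1 else y n)"
    using assms by (auto simp: coroot_def value_add value_diff value_Const value_Var)
  then have "poly_value n (\<lambda>c. c) y (Const c + coroot n i) \<noteq> 0"
    by (simp add: y_def)
  with eq value_zero show False by simp
qed

section \<open>Moving polynomials past group elements\<close>

locale daha = degenerate_daha +
  assumes rank: "2 \<le> n"
begin

sublocale eval: poly_evaluation n "\<lambda>c. sc c 1" X
  by unfold_locales
    (simp_all add: scale_left_distrib scale_mult_left scale_mult_right X_commute)

abbreviation r :: "nat \<Rightarrow> 'a" where "r i \<equiv> \<rho> (simple_refl n i)"
abbreviation \<pi> :: "mpoly \<Rightarrow> 'a" where "\<pi> \<equiv> poly_at sc n X"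
abbreviation k :: "nat \<Rightarrow> complex" where "k \<equiv> mult_param n t0 u0 t tn un"
abbreviation T :: "nat \<Rightarrow> 'a" where "T \<equiv> T_gen sc n t0 u0 tn un \<rho> X"
abbreviation TW :: "nat list \<Rightarrow> 'a" where "TW \<equiv> T_word sc n t0 u0 tn un \<rho> X"

lemma scalar_commute: "sc c 1 * x = x * sc c 1"
  by (simp add: scale_mult_left scale_mult_right)

lemma rho_append:
  "set u \<subseteq> {0..n} \<Longrightarrow> set v \<subseteq> {0..n} \<Longrightarrow>
    \<rho> (word_class n (u @ v)) = \<rho> (word_class n u) * \<rho> (word_class n v)"
  using rho_mult[of "word_class n u" "word_class n v"] rank
  by (simp add: word_class_in_carrier word_class_mult)

lemma rho_word: "set u \<subseteq> {0..n} \<Longrightarrow> \<rho> (word_class n u) = (\<Prod>i\<leftarrow>u. r i)"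
proof (induction u)
  case Nil
  then show ?case using rho_one by (simp add: affine_weyl_def)
next
  case (Cons i u)
  then show ?case using rho_append[of "[i]" u] by simp
qed

lemma word_equiv_prod_r: "word_equiv n u v \<Longrightarrow> (\<Prod>i\<leftarrow>u. r i) = (\<Prod>i\<leftarrow>v. r i)"
  using word_class_eq_iff[of u n v] word_equiv_words[of n u v] rank
  by (metis rho_word)

lemma r_square: "i \<le> n \<Longrightarrow> r i * r i = 1"
  using word_equiv_prod_r[OF word_equiv_square[of i n]] by simp

text \<open>\<open>e\<close> is the divided difference \<open>(s_i x_j - x_j) / a_i\<close>, the
  quotient needed to apply the cross relation to a variable.\<close>

lemma refl_poly_Var_diff:
  assumes "i \<le> n" "j \<in> {1..n}"
  defines "e \<equiv> if i = 0 \<and> j = 1 then 1 else if i = n \<and> j = n then - 1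
    else if i \<noteq> 0 \<and> i \<noteq> n \<and> j = i then - 1 else if i \<noteq> 0 \<and> i \<noteq> n \<and> j = i + 1 then 1 else 0"
  shows "affine_root n i * e = refl_poly n i (Var j) - Var j"
    and "e \<in> polys n"
proof -
  have "Const 2 = 1 + 1" using Const_add[of 1 1] by simp
  then show "affine_root n i * e = refl_poly n i (Var j) - Var j"
    using assms rank by (auto simp: affine_root_def refl_poly_Var refl_point_def algebra_simps)
  show "e \<in> polys n" unfolding e_def by (auto intro: polys_uminus)
qed

lemma r_X:
  assumes "i \<le> n" "j \<in> {1..n}"
  shows "r i * X j = \<pi> (refl_poly n i (Var j)) * r i +
    sc (k i) (if i = 0 \<and> j = 1 then 1 else if i = n \<and> j = n then - 1
      else if i \<noteq> 0 \<and> i \<noteq> n \<and> j = i then - 1 else if i \<noteq> 0 \<and> i \<noteq> n \<and> j = i + 1 then 1 else 0)"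
proof -
  note cross_relation[OF _ _ refl_poly_Var_diff(2)[OF assms] refl_poly_Var_diff(1)[OF assms]]
  then show ?thesis
    using assms
    by (auto simp: eval.value_Var eval.value_one eval.value_uminus eval.value_zero algebra_simps
        split: if_splits)
qed

text \<open>The cross relation read in the order of the decomposition, group element first. Checking
  it on generators leaves only the divided differences of the variables to be exhibited.\<close>

lemma poly_r:
  assumes "p \<in> polys n" "i \<le> n"
  shows "\<exists>q\<in>polys n. \<pi> p * r i = r i * \<pi> (refl_poly n i p) + \<pi> q"
  using assms
proof (induction rule: polys_induct)
  case (Const c)
  then show ?case
    by (intro bexI[of _ 0]) (simp_all add: eval.value_Const eval.value_zero scale_mult_left scale_mult_right)
next
  case (Var j)
  from refl_poly_Var_diff[OF Var(2,1)] obtain e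
    where e: "e \<in> polys n" "affine_root n i * e = refl_poly n i (Var j) - Var j" by blast
  have V: "Var j \<in> polys n" using Var by simp
  \<comment> \<open>The cross relation is applied to \<open>s_i x_j\<close> instead of
    \<open>x_j\<close>, which changes the sign of the quotient because \<open>s_i\<close> is an
    involution.\<close>
  have "r i * \<pi> (refl_poly n i (Var j)) - \<pi> (Var j) * r i = sc (k i) (\<pi> (- e))"
    using cross_relation[of i "refl_poly n i (Var j)" "- e"] e V Var(2) rank
      refl_poly_involution[OF V Var(2) rank] refl_poly_in_polys[OF V Var(2) rank]
    by (simp add: polys_uminus)
  then have "\<pi> (Var j) * r i = r i * \<pi> (refl_poly n i (Var j)) + \<pi> (Const (k i) * e)"
    unfolding eval.value_mult eval.value_Const eval.value_uminus
    by (simp add: scale_mult_left diff_eq_eq add.commute)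
  then show ?case using e by (intro bexI[of _ "Const (k i) * e"]) (auto intro: polys_mult)
next
  case (add p q)
  then obtain p' q' where "p' \<in> polys n" "q' \<in> polys n"
    "\<pi> p * r i = r i * \<pi> (refl_poly n i p) + \<pi> p'" "\<pi> q * r i = r i * \<pi> (refl_poly n i q) + \<pi> q'"
    by blast
  then show ?case
    by (intro bexI[of _ "p' + q'"]) (auto simp: eval.value_add algebra_simps intro: polys_add)
next
  case (mult p q)
  then obtain p' q' where *: "p' \<in> polys n" "q' \<in> polys n"
    "\<pi> p * r i = r i * \<pi> (refl_poly n i p) + \<pi> p'" "\<pi> q * r i = r i * \<pi> (refl_poly n i q) + \<pi> q'"
    by blast
  have "\<pi> (p * q) * r i = (\<pi> p * r i) * \<pi> (refl_poly n i q) + \<pi> p * \<pi> q'"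
    using *(4) by (simp add: eval.value_mult mult.assoc distrib_left)
  also have "\<dots> = r i * \<pi> (refl_poly n i (p * q)) + \<pi> (p' * refl_poly n i q + p * q')"
    unfolding *(3) by (simp add: eval.value_mult eval.value_add mult.assoc distrib_right distrib_left)
  finally show ?case
    using * mult refl_poly_in_polys[of q n i] rank by (blast intro: polys_add polys_mult)
qed

section \<open>The length filtration and leading terms\<close>

inductive_set low :: "nat \<Rightarrow> 'a set" for m where
  zero: "0 \<in> low m"
| add: "\<lbrakk>a \<in> low m; set u \<subseteq> {0..n}; length u < m; p \<in> polys n\<rbrakk>
    \<Longrightarrow> a + \<rho> (word_class n u) * \<pi> p \<in> low m"

lemma low_term:
  "\<lbrakk>set u \<subseteq> {0..n}; length u < m; p \<in> polys n\<rbrakk> \<Longrightarrow> \<rho> (word_class n u) * \<pi> p \<in> low m"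
  using low.add[OF low.zero] by simp

lemma low_add: "b \<in> low m \<Longrightarrow> a \<in> low m \<Longrightarrow> a + b \<in> low m"
proof (induction b rule: low.induct)
  case (add b u p)
  then show ?case using low.add[of "a + b" m u p] by (simp add: add.assoc)
qed simp

lemma low_mono: "a \<in> low m \<Longrightarrow> m \<le> m' \<Longrightarrow> a \<in> low m'"
  by (induction rule: low.induct) (auto intro: low.intros)

lemma low_mult_poly: "a \<in> low m \<Longrightarrow> q \<in> polys n \<Longrightarrow> a * \<pi> q \<in> low m"
proof (induction rule: low.induct)
  case (add a u p)
  then show ?case
    using low.add[of "a * \<pi> q" m u "p * q"]
    by (simp add: distrib_right eval.value_mult mult.assoc polys_mult)
qed (simp add: low.zero)

lemma term_mult_r:
  assumes "set u \<subseteq> {0..n}" "p \<in> polys n" "i \<le> n"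
  shows "\<exists>q\<in>polys n. \<rho> (word_class n u) * \<pi> p * r i =
    \<rho> (word_class n (u @ [i])) * \<pi> (refl_poly n i p) + \<rho> (word_class n u) * \<pi> q"
proof -
  from poly_r[OF assms(2,3)] obtain q
    where "q \<in> polys n" "\<pi> p * r i = r i * \<pi> (refl_poly n i p) + \<pi> q" by blast
  with assms show ?thesis
    by (intro bexI[of _ q]) (simp_all add: mult.assoc distrib_left rho_append)
qed

lemma low_mult_r: "a \<in> low m \<Longrightarrow> i \<le> n \<Longrightarrow> a * r i \<in> low (Suc m)"
proof (induction rule: low.induct)
  case (add a u p)
  from term_mult_r[of u p i] add obtain q where q: "q \<in> polys n"
    "\<rho> (word_class n u) * \<pi> p * r i =
      \<rho> (word_class n (u @ [i])) * \<pi> (refl_poly n i p) + \<rho> (word_class n u) * \<pi> q" by blast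
  have "\<rho> (word_class n (u @ [i])) * \<pi> (refl_poly n i p) \<in> low (Suc m)"
    "\<rho> (word_class n u) * \<pi> q \<in> low (Suc m)"
    using add q rank by (auto intro!: low_term refl_poly_in_polys)
  with add q show ?case
    by (simp add: distrib_right low_add)
qed (simp add: low.zero)

lemma low_scale: "a \<in> low m \<Longrightarrow> sc c a \<in> low m"
  using low_mult_poly[of a m "Const c"] by (simp add: eval.value_Const scale_mult_right)

definition end_param :: "nat \<Rightarrow> complex \<times> complex" where
  "end_param i = (if i = 0 then (t0, u0) else (tn, un))"

lemma T_end:
  assumes "i \<in> {0, n}"
  shows "T i = sc (fst (end_param i)) 1 + sc (1 / 2)
    (\<pi> (Const (fst (end_param i) - snd (end_param i)) + coroot n i) * (r i - 1))"
  using assms by (auto simp: T_gen_def end_param_def Let_def eval.value_add eval.value_Const)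

lemma T_middle: "i \<notin> {0, n} \<Longrightarrow> T i = r i"
  by (simp add: T_gen_def)

lemma T_decomposition:
  assumes "i \<le> n"
  shows "\<exists>f\<in>polys n. \<exists>g\<in>polys n. f \<noteq> 0 \<and> T i = \<pi> f * r i + \<pi> g"
proof (cases "i \<in> {0, n}")
  case True
  define h where "h = Const (fst (end_param i) - snd (end_param i)) + coroot n i"
  have h: "h \<in> polys n" "h \<noteq> 0"
    using True rank Const_add_coroot_nonzero[OF True rank]
    by (auto simp: h_def intro!: polys_add coroot_in_polys)
  have "T i = \<pi> (Const (1 / 2) * h) * r i + \<pi> (Const (fst (end_param i)) - Const (1 / 2) * h)"
    unfolding T_end[OF True] h_def[symmetric]
    by (simp add: eval.value_mult eval.value_diff eval.value_Const scale_mult_left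
        right_diff_distrib scale_right_diff_distrib)
  moreover have "Const (1 / 2) * h \<in> polys n" "Const (fst (end_param i)) - Const (1 / 2) * h \<in> polys n"
    using h by (auto intro!: polys_mult polys_diff)
  moreover have "Const (1 / 2) * h \<noteq> 0" using h by simp
  ultimately show ?thesis by blast
next
  case False
  then have "T i = \<pi> 1 * r i + \<pi> 0" by (simp add: T_middle eval.value_one eval.value_zero)
  then show ?thesis using polys_0 polys_1 zero_neq_one by metis
qed

text \<open>Appending \<open>i\<close> turns the leading coefficient \<open>p\<close> into
  \<open>s_i (p f)\<close>. This is nonzero because polynomials have no zero divisors and
  \<open>s_i\<close> is injective on them.\<close>

lemma T_word_leading_term:
  assumes "set u \<subseteq> {0..n}"
  shows "\<exists>p\<in>polys n. \<exists>a\<in>low (length u). p \<noteq> 0 \<and> TW u = \<rho> (word_class n u) * \<pi> p + a"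
  using assms
proof (induction u rule: rev_induct)
  case Nil
  have "TW [] = \<rho> (word_class n []) * \<pi> 1 + 0" by (simp add: T_word_def rho_word eval.value_one)
  then show ?case using polys_1 low.zero zero_neq_one by metis
next
  case (snoc i u)
  then obtain p a where pa: "p \<in> polys n" "a \<in> low (length u)" "p \<noteq> 0"
    "TW u = \<rho> (word_class n u) * \<pi> p + a" by auto
  from snoc have i: "i \<le> n" and u: "set u \<subseteq> {0..n}" by auto
  from T_decomposition[OF i] obtain f g where fg: "f \<in> polys n" "g \<in> polys n" "f \<noteq> 0"
    "T i = \<pi> f * r i + \<pi> g" by blast
  have pf: "p * f \<in> polys n" "p * g \<in> polys n" using pa fg by (auto intro: polys_mult)
  from term_mult_r[OF u pf(1) i] obtain q where q: "q \<in> polys n" "\<rho> (word_class n u) * \<pi> (p * f) * r i =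
    \<rho> (word_class n (u @ [i])) * \<pi> (refl_poly n i (p * f)) + \<rho> (word_class n u) * \<pi> q" by blast
  \<comment> \<open>Everything except the new leading term: the correction from moving
    \<open>r i\<close> to the left, the part \<open>\<pi> g\<close> of \<open>T i\<close>, and the
    old remainder \<open>a\<close> multiplied by \<open>T i\<close>.\<close>
  define b where "b = \<rho> (word_class n u) * \<pi> q + \<rho> (word_class n u) * \<pi> (p * g) + a * \<pi> f * r i + a * \<pi> g"
  have "b \<in> low (Suc (length u))"
    unfolding b_def using pa fg q pf u i
    by (intro low_add low_term low_mult_r low_mult_poly) (auto intro: low_mono)
  moreover have "TW (u @ [i]) = (\<rho> (word_class n u) * \<pi> p + a) * (\<pi> f * r i + \<pi> g)"
    using pa(4) fg(4) by (simp add: T_word_def)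
  then have "TW (u @ [i]) = \<rho> (word_class n (u @ [i])) * \<pi> (refl_poly n i (p * f)) + b"
    using q(2) unfolding b_def
    by (simp add: eval.value_mult[of p f] eval.value_mult[of p g] distrib_left distrib_right mult.assoc
        add.assoc del: refl_poly_mult)
  moreover have "refl_poly n i (p * f) \<noteq> 0"
    using refl_poly_eq_0_iff[OF pf(1) i rank] pa fg by simp
  ultimately have "\<exists>p\<in>polys n. \<exists>a\<in>low (Suc (length u)).
      p \<noteq> 0 \<and> TW (u @ [i]) = \<rho> (word_class n (u @ [i])) * \<pi> p + a"
    using refl_poly_in_polys[OF pf(1) i rank] by blast
  then show ?case by simp
qed

section \<open>Coordinates in the decomposition and linear independence\<close>

text \<open>The inverse of the multiplication map in \<open>pbw\<close>: the family of polynomial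
  coefficients of an element, indexed by the group.\<close>

definition expansion :: "'a \<Rightarrow> nat list set \<Rightarrow>\<^sub>0 mpoly" where
  "expansion a = inv_into
     {F. Poly_Mapping.keys F \<subseteq> carrier (affine_weyl n) \<and> (\<forall>w. Poly_Mapping.lookup F w \<in> polys n)}
     (\<lambda>F. \<Sum>w\<in>Poly_Mapping.keys F. \<rho> w * \<pi> (Poly_Mapping.lookup F w)) a"

lemma expansion_unique:
  assumes "Poly_Mapping.keys F \<subseteq> carrier (affine_weyl n)" "\<And>w. Poly_Mapping.lookup F w \<in> polys n"
    and "a = (\<Sum>w\<in>Poly_Mapping.keys F. \<rho> w * \<pi> (Poly_Mapping.lookup F w))"
  shows "expansion a = F"
  unfolding expansion_def assms(3)
  by (rule inv_into_f_f) (use pbw assms in \<open>auto simp: bij_betw_def\<close>)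

lemma expansion_sound:
  "Poly_Mapping.keys (expansion a) \<subseteq> carrier (affine_weyl n)"
  "Poly_Mapping.lookup (expansion a) w \<in> polys n"
  "(\<Sum>w\<in>Poly_Mapping.keys (expansion a). \<rho> w * \<pi> (Poly_Mapping.lookup (expansion a) w)) = a"
proof -
  let ?D = "{F. Poly_Mapping.keys F \<subseteq> carrier (affine_weyl n) \<and> (\<forall>w. Poly_Mapping.lookup F w \<in> polys n)}"
  let ?f = "\<lambda>F. \<Sum>w\<in>Poly_Mapping.keys F. \<rho> w * \<pi> (Poly_Mapping.lookup F w)"
  have a: "a \<in> ?f ` ?D" using pbw unfolding bij_betw_def by blast
  have "expansion a \<in> ?D" unfolding expansion_def by (rule inv_into_into[OF a])
  then show "Poly_Mapping.keys (expansion a) \<subseteq> carrier (affine_weyl n)"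
    "Poly_Mapping.lookup (expansion a) w \<in> polys n" by blast+
  show "?f (expansion a) = a" unfolding expansion_def by (rule f_inv_into_f[OF a])
qed

lemma expansion_add: "expansion (a + b) = expansion a + expansion b"
proof (rule expansion_unique)
  let ?A = "expansion a" and ?B = "expansion b"
  show "Poly_Mapping.keys (?A + ?B) \<subseteq> carrier (affine_weyl n)"
    using Poly_Mapping.keys_add[of ?A ?B] expansion_sound(1) by blast
  show "Poly_Mapping.lookup (?A + ?B) w \<in> polys n" for w
    by (simp add: lookup_add polys_add expansion_sound(2))
  let ?S = "Poly_Mapping.keys ?A \<union> Poly_Mapping.keys ?B"
  have *: "(\<Sum>w\<in>Poly_Mapping.keys F. \<rho> w * \<pi> (Poly_Mapping.lookup F w)) =
      (\<Sum>w\<in>?S. \<rho> w * \<pi> (Poly_Mapping.lookup F w))" if "Poly_Mapping.keys F \<subseteq> ?S" for F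
    using that by (intro sum.mono_neutral_left) (auto simp: in_keys_iff eval.value_zero)
  have "a + b = (\<Sum>w\<in>?S. \<rho> w * \<pi> (Poly_Mapping.lookup ?A w))
      + (\<Sum>w\<in>?S. \<rho> w * \<pi> (Poly_Mapping.lookup ?B w))"
    using *[of ?A] *[of ?B] by (simp add: expansion_sound(3))
  also have "\<dots> = (\<Sum>w\<in>?S. \<rho> w * \<pi> (Poly_Mapping.lookup (?A + ?B) w))"
    by (simp add: lookup_add eval.value_add distrib_left sum.distrib)
  also have "\<dots> = (\<Sum>w\<in>Poly_Mapping.keys (?A + ?B). \<rho> w * \<pi> (Poly_Mapping.lookup (?A + ?B) w))"
    by (rule *[symmetric]) (rule Poly_Mapping.keys_add)
  finally show "a + b = \<dots>" .
qed

lemma expansion_zero: "expansion 0 = 0"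
  using expansion_add[of 0 0] by simp

lemma expansion_sum: "expansion (\<Sum>i\<in>S. f i) = (\<Sum>i\<in>S. expansion (f i))"
  by (induction S rule: infinite_finite_induct) (simp_all add: expansion_add expansion_zero)

lemma expansion_term:
  assumes "w \<in> carrier (affine_weyl n)" "p \<in> polys n"
  shows "expansion (\<rho> w * \<pi> p) = Poly_Mapping.single w p"
  using assms by (intro expansion_unique) (auto simp: lookup_single when_def eval.value_zero)

text \<open>A word shorter than a reduced word \<open>v\<close> represents a different group
  element, so no term of \<open>a\<close> contributes at the class of \<open>v\<close>.\<close>

lemma expansion_low:
  assumes "a \<in> low m" "reduced_word n v" "m \<le> length v"
  shows "Poly_Mapping.lookup (expansion a) (word_class n v) = 0"
  using assms
proof (induction rule: low.induct)
  case (add a u p)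
  have "word_class n u \<noteq> word_class n v"
  proof
    assume "word_class n u = word_class n v"
    then have "word_equiv n v u"
      using word_class_eq_iff[of v n u] add.prems by (simp add: reduced_word_def)
    with add show False by (force simp: reduced_word_def)
  qed
  with add show ?case
    by (simp add: expansion_add lookup_add expansion_term word_class_in_carrier lookup_single)
qed (simp add: expansion_zero)

lemma T_words_independent:
  assumes wbar: "\<And>w. w \<in> carrier (affine_weyl n) \<Longrightarrow> reduced_expression w (wbar w)"
    and S: "finite S" "S \<subseteq> carrier (affine_weyl n)"
    and sum: "(\<Sum>w\<in>S. sc (c w) (TW (wbar w))) = 0"
    and "w \<in> S"
  shows "c w = 0"
proof (rule ccontr)
  assume "c w \<noteq> 0"
  define S' where "S' = {w \<in> S. c w \<noteq> 0}"
  have S': "finite S'" "w \<in> S'" using S \<open>w \<in> S\<close> \<open>c w \<noteq> 0\<close> by (auto simp: S'_def)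
  \<comment> \<open>Minimising the negated length picks an element of maximal length among those
    with nonzero coefficient.\<close>
  define v where "v = arg_min_on (\<lambda>w. - int (length (wbar w))) S'"
  have v: "v \<in> S'" using S' arg_min_if_finite(1)[of S'] unfolding v_def by blast
  have max: "length (wbar w) \<le> length (wbar v)" if "w \<in> S'" for w
    using arg_min_least[OF S'(1) _ that, of "\<lambda>w. - int (length (wbar w))"] S' unfolding v_def by auto
  have red: "w = word_class n (wbar w)" "reduced_word n (wbar w)" if "w \<in> S'" for w
    using reduced_expressionD[OF wbar _ rank] that S by (auto simp: S'_def)
  \<comment> \<open>The remainder of each product vanishes at \<open>v\<close> by maximality of
    \<open>v\<close>, and its leading term sits at \<open>w\<close> itself. Hence only the summand
    of \<open>v\<close> contributes.\<close>
  have coeff: "Poly_Mapping.lookup (expansion (sc (c w) (TW (wbar w)))) v = 0 \<longleftrightarrow> w \<noteq> v"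
    if "w \<in> S'" for w
  proof -
    from T_word_leading_term[of "wbar w"] red[OF that] obtain p a
      where pa: "p \<in> polys n" "a \<in> low (length (wbar w))" "p \<noteq> 0" "TW (wbar w) = \<rho> w * \<pi> p + a"
      by (auto simp: reduced_word_def)
    have "sc (c w) (TW (wbar w)) = \<rho> w * \<pi> (Const (c w) * p) + sc (c w) a"
      by (simp add: pa(4) scale_right_distrib eval.value_mult eval.value_Const scale_mult_left
          scale_mult_right)
    moreover have "Poly_Mapping.lookup (expansion (sc (c w) a)) v = 0"
      using expansion_low[OF low_mono[OF low_scale[OF pa(2)] max[OF that]] red(2)[OF v]] red(1)[OF v]
      by simp
    moreover have "expansion (\<rho> w * \<pi> (Const (c w) * p)) = Poly_Mapping.single w (Const (c w) * p)"
      using that S pa(1) by (intro expansion_term) (auto simp: S'_def intro: polys_mult)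
    ultimately show ?thesis
      using that pa(3) by (auto simp: S'_def expansion_add lookup_add lookup_single when_def)
  qed
  have "(\<Sum>w\<in>S'. sc (c w) (TW (wbar w))) = 0"
    unfolding sum[symmetric] S'_def using S by (intro sum.mono_neutral_left) auto
  then have "(\<Sum>w\<in>S'. Poly_Mapping.lookup (expansion (sc (c w) (TW (wbar w)))) v) = 0"
    using expansion_sum[of "\<lambda>w. sc (c w) (TW (wbar w))" S']
    by (simp add: expansion_zero lookup_sum[symmetric])
  moreover have "(\<Sum>w\<in>S'. Poly_Mapping.lookup (expansion (sc (c w) (TW (wbar w)))) v)
    = Poly_Mapping.lookup (expansion (sc (c v) (TW (wbar v)))) v"
    using S' v coeff by (subst sum.remove[of _ v]) (auto intro!: sum.neutral)
  ultimately show False using coeff[OF v] by simp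
qed

section \<open>Quadratic and braid relations of the generators of H\<close>

text \<open>At both ends the coroot is \<open>a_i / 2\<close>. Thus \<open>s_i\<close> negates it,
  and its divided difference is \<open>- 1\<close>.\<close>

lemma r_end_coroot:
  assumes "i \<in> {0, n}"
  shows "r i * \<pi> (coroot n i) = - (\<pi> (coroot n i) * r i) - sc (k i) 1"
proof -
  have half: "sc (1 / 2) z + sc (1 / 2) z = z" "sc (1 / 2) z + (sc (1 / 2) z + y) = z + y" for y z
    by (simp_all add: add.assoc[symmetric] scale_left_distrib[symmetric])
  show ?thesis
    using assms rank r_X[of i "if i = 0 then 1 else n"]
    by (auto simp: coroot_def eval.value_diff eval.value_Const eval.value_Var eval.value_uminus
        eval.value_one refl_poly_Var refl_point_def scale_mult_left scale_mult_right half algebra_simps)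
qed

lemma T_end_square:
  assumes "i \<in> {0, n}"
  shows "T i * T i = sc (fst (end_param i) * fst (end_param i)) 1"
proof -
  obtain a u where au: "end_param i = (a, u)" by (cases "end_param i")
  define x where "x = \<pi> (Const (a - u) + coroot n i)"
  define P where "P = x * (r i - 1)"
  have i: "i \<le> n" "r i * r i = 1" using assms r_square by auto
  have k: "k i = 2 * a + 2 * u" using assms au rank by (auto simp: mult_param_def end_param_def)
  have "r i * x = sc (a - u) 1 * r i + sc (a - u) 1 * r i - x * r i - sc (k i) 1"
    using r_end_coroot[OF assms]
    by (simp add: x_def eval.value_add eval.value_Const distrib_left distrib_right
        scalar_commute[of "a - u" "r i"])
  from quadratic_identity[OF i(2) this]
  have "P * P = - ((sc (a - u) 1 + sc (a - u) 1 + sc (k i) 1) * P)"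
    by (simp add: P_def scalar_commute)
  \<comment> \<open>This is where the parametrisation \<open>k_i = 2 t_i + 2 u_i\<close> enters:
    \<open>2 (t_i - u_i) + k_i = 4 t_i\<close>, so \<open>u_i\<close> drops out of the square of
    \<open>T i\<close>.\<close>
  also have "sc (a - u) 1 + sc (a - u) 1 + sc (k i) 1 = sc (4 * a) 1"
    by (simp add: k scale_left_distrib[symmetric])
  finally have PP: "P * P = - sc (4 * a) P" by (simp add: scale_mult_left)
  have "T i = sc a 1 + sc (1 / 2) P" using T_end[OF assms] by (simp add: au P_def x_def)
  then have "T i * T i = sc (a * a) 1 + (sc (a / 2) P + sc (a / 2) P + sc (1 / 4) (P * P))"
    by (simp add: distrib_left distrib_right scale_mult_left scale_mult_right scale_right_distrib
        add.assoc)
  also have "sc (a / 2) P + sc (a / 2) P + sc (1 / 4) (P * P) = 0"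
    by (simp add: PP scale_left_distrib[symmetric])
  finally show ?thesis by (simp add: au)
qed

lemma T_square_scalar:
  assumes "i \<le> n"
  shows "\<exists>c. T i * T i = sc c 1"
proof (cases "i \<in> {0, n}")
  case True
  then show ?thesis using T_end_square by blast
next
  case False
  then show ?thesis using r_square[OF assms] by (intro exI[of _ 1]) (simp add: T_middle)
qed

text \<open>Reduces commutation with \<open>T i\<close> to its ingredients \<open>r i\<close> and,
  at the ends, the coroot. For two distant generators it is applied to one factor after the
  other.\<close>

lemma commutes_T:
  assumes "i \<le> n" "z * r i = r i * z" "i \<in> {0, n} \<Longrightarrow> z * \<pi> (coroot n i) = \<pi> (coroot n i) * z"
  shows "z * T i = T i * z"
proof (cases "i \<in> {0, n}")
  case True
  define x where "x = \<pi> (Const (fst (end_param i) - snd (end_param i)) + coroot n i)"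
  have "z * x = x * z"
    using assms(3)[OF True]
    by (simp add: x_def eval.value_add eval.value_Const distrib_left distrib_right scalar_commute)
  moreover have "z * (r i - 1) = (r i - 1) * z"
    using assms(2) by (simp add: left_diff_distrib right_diff_distrib)
  ultimately have "z * (x * (r i - 1)) = (x * (r i - 1)) * z" by (metis mult.assoc)
  then show ?thesis
    unfolding T_end[OF True] x_def[symmetric]
    by (simp add: distrib_left distrib_right scale_mult_left scale_mult_right)
next
  case False
  then show ?thesis using assms(2) by (simp add: T_middle)
qed

lemma r_commute_coroot:
  assumes "i \<le> n" "j \<in> {0, n}" "i + 2 \<le> j \<or> j + 2 \<le> i"
  shows "r i * \<pi> (coroot n j) = \<pi> (coroot n j) * r i"
  using assms rank r_X[of i "if j = 0 then 1 else n"]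
  by (auto simp: coroot_def eval.value_diff eval.value_Const eval.value_Var refl_poly_Var
      refl_point_def left_diff_distrib right_diff_distrib scale_mult_left scale_mult_right)

lemma T_commute:
  assumes "i \<le> n" "j \<le> n" "i + 2 \<le> j \<or> j + 2 \<le> i"
  shows "T i * T j = T j * T i"
proof -
  have rr: "r i * r j = r j * r i"
    using word_equiv_prod_r[OF word_equiv_alternating[of i n j]] assms rank
    by (auto simp: coxeter_order_def eval_nat_numeral)
  have "r j * T i = T i * r j"
    using assms rr r_commute_coroot[of j i] by (intro commutes_T) auto
  moreover have "T i * \<pi> (coroot n j) = \<pi> (coroot n j) * T i" if "j \<in> {0, n}"
    using assms that r_commute_coroot[of i j]
    by (intro commutes_T[symmetric]) (auto simp: eval.value_mult[symmetric] mult.commute)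
  ultimately show ?thesis
    using assms by (intro commutes_T) auto
qed

lemma T_braid_three:
  assumes "i \<notin> {0, n}" "j \<notin> {0, n}" "i \<le> n" "j \<le> n" "coxeter_order n i j = 3" "i \<noteq> j"
  shows "T i * T j * T i = T j * T i * T j"
  using word_equiv_prod_r[OF word_equiv_alternating[of i n j]] assms rank
  by (simp add: eval_nat_numeral T_middle mult.assoc)

lemma T_braid_four:
  assumes "i \<in> {0, n}" "j = (if i = 0 then 1 else n - 1)"
  shows "T i * T j * T i * T j - T j * T i * T j * T i = sc t (T j * T i - T i * T j)"
proof -
  obtain a u where au: "end_param i = (a, u)" by (cases "end_param i")
  define x where "x = \<pi> (Const (a - u) + coroot n i)"
  \<comment> \<open>\<open>y\<close> is the image of \<open>x\<close> under \<open>s_j\<close>. The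
    variable moved by the end reflection \<open>s_i\<close> no longer occurs in it, so
    \<open>y\<close> commutes with \<open>r i\<close>.\<close>
  define y where "y = \<pi> (Const (a - u) + (if i = 0 then Const (1 / 2) - Var 2 else Var (n - 1)))"
  define P where "P = x * (r i - 1)"
  define s where "s = r j"
  have ij: "i \<le> n" "j \<le> n" "j \<notin> {0, n}" "i \<noteq> j" "coxeter_order n i j = 4"
    using assms rank by (auto simp: coxeter_order_def)
  have xy: "y * x = x * y"
    by (simp add: x_def y_def eval.value_mult[symmetric] mult.commute)
  have ry: "r i * y = y * r i"
    using assms ij rank r_X[of i "if i = 0 then 2 else n - 1"]
    by (auto simp: y_def eval.value_add eval.value_diff eval.value_Const eval.value_Var refl_poly_Var
        refl_point_def distrib_left distrib_right left_diff_distrib right_diff_distrib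
        scale_mult_left scale_mult_right)
  have kj: "k j = t" using ij by (auto simp: mult_param_def)
  have sx: "s * x = y * s + sc t 1"
    using assms ij rank r_X[of j "if i = 0 then 1 else n"] kj
    by (auto simp: s_def x_def y_def coroot_def eval.value_add eval.value_diff eval.value_Const
        eval.value_Var refl_poly_Var refl_point_def distrib_left distrib_right left_diff_distrib
        right_diff_distrib scale_mult_left scale_mult_right eval_nat_numeral)
  have rs: "r i * s * r i * s = s * r i * s * r i"
    using word_equiv_prod_r[OF word_equiv_alternating[of i n j]] ij rank
    by (simp add: s_def eval_nat_numeral mult.assoc)
  have ss: "s * s = 1" using r_square ij by (simp add: s_def)
  have id: "P * s * P * s - s * P * s * P = sc t 1 * (s * P - P * s) + sc t 1 * (s * P - P * s)"
    unfolding P_def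
    by (rule four_braid_identity[OF r_square[OF ij(1)] ss rs xy ry sx scalar_commute[symmetric]])
  have T: "T i = sc a 1 + sc (1 / 2) P" "T j = s"
    using T_end[OF assms(1)] T_middle[OF ij(3)] by (simp_all add: au P_def x_def s_def)
  \<comment> \<open>With \<open>T i = a + P / 2\<close> and \<open>ss\<close>, the terms linear in
    \<open>P\<close> are \<open>a / 2\<close> times \<open>P + s P s\<close> in both products and
    cancel, as do the constants \<open>a * a\<close>.\<close>
  have "T i * T j * T i * T j - T j * T i * T j * T i = sc (1 / 4) (P * s * P * s - s * P * s * P)"
    unfolding T
    by (simp add: distrib_left distrib_right scale_mult_left scale_mult_right scale_right_distrib
        scale_right_diff_distrib mult.assoc ss add.commute)
  also have "\<dots> = sc (1 / 4) (sc (2 * t) (s * P - P * s))"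
    unfolding id by (simp add: scale_mult_left scale_left_distrib[symmetric])
  also have "\<dots> = sc t (T j * T i - T i * T j)"
    unfolding T
    by (simp add: distrib_left distrib_right scale_mult_left scale_mult_right scale_right_distrib
        scale_right_diff_distrib)
  finally show ?thesis .
qed

section \<open>Spanning by the chosen products\<close>

text \<open>The analogue of \<open>low\<close> inside \<open>H\<close>: a length filtration by
  products of the \<open>T i\<close>, with complex coefficients.\<close>

definition shorter :: "nat \<Rightarrow> 'a set" where
  "shorter m = span {TW u | u. set u \<subseteq> {0..n} \<and> length u < m}"

lemma T_word_append: "TW (u @ v) = TW u * TW v"
  by (simp add: T_word_def)

lemma shorter_T_word: "set u \<subseteq> {0..n} \<Longrightarrow> length u < m \<Longrightarrow> TW u \<in> shorter m"
  unfolding shorter_def by (rule span_base) blast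

lemma shorter_mult:
  assumes "a \<in> shorter m" "set u \<subseteq> {0..n}" "set v \<subseteq> {0..n}"
  shows "TW u * a * TW v \<in> shorter (length u + m + length v)"
  using assms(1) unfolding shorter_def
proof (induction rule: span_induct_alt)
  case base
  then show ?case by (simp add: span_zero)
next
  case (step c x y)
  then obtain w where w: "set w \<subseteq> {0..n}" "length w < m" "x = TW w" by blast
  have "TW u * x * TW v \<in> span {TW w |w. set w \<subseteq> {0..n} \<and> length w < length u + m + length v}"
    using shorter_T_word[of "u @ w @ v" "length u + m + length v"] w assms
    by (simp add: shorter_def T_word_append mult.assoc)
  with step show ?case
    by (simp add: distrib_left distrib_right scale_mult_left scale_mult_right span_add span_scale)
qed

lemma shorter_diff: "a \<in> shorter m \<Longrightarrow> b \<in> shorter m \<Longrightarrow> a - b \<in> shorter m"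
  unfolding shorter_def by (rule span_diff)

lemma shorter_add: "a \<in> shorter m \<Longrightarrow> b \<in> shorter m \<Longrightarrow> a + b \<in> shorter m"
  unfolding shorter_def by (rule span_add)

lemma shorter_scale: "a \<in> shorter m \<Longrightarrow> sc c a \<in> shorter m"
  unfolding shorter_def by (rule span_scale)

lemma shorter_0: "0 \<in> shorter m"
  unfolding shorter_def by (rule span_zero)

lemma T_word_alternating_diff:
  assumes "i \<le> n" "j \<le> n" "i \<noteq> j"
  defines "m \<equiv> coxeter_order n i j"
  shows "TW (alternating i j m) - TW (alternating j i m) \<in> shorter m"
proof -
  \<comment> \<open>Both signs are recorded because either of the two letters may be the end
    generator.\<close>
  have four: "TW (alternating i j 4) - TW (alternating j i 4) \<in> shorter 4
      \<and> TW (alternating j i 4) - TW (alternating i j 4) \<in> shorter 4"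
    if "i \<in> {0, n}" "j = (if i = 0 then 1 else n - 1)" for i j
  proof -
    have ij: "i \<le> n" "j \<le> n" using that rank by auto
    have "TW [j, i] - TW [i, j] \<in> shorter 4"
      using ij by (intro shorter_diff shorter_T_word) auto
    moreover have "TW (alternating i j 4) - TW (alternating j i 4) = sc t (TW [j, i] - TW [i, j])"
      using T_braid_four[OF that] by (simp add: T_word_def eval_nat_numeral mult.assoc)
    moreover from this have "TW (alternating j i 4) - TW (alternating i j 4)
        = sc (- t) (TW [j, i] - TW [i, j])"
      unfolding scale_minus_left by (metis minus_diff_eq)
    ultimately show ?thesis using shorter_scale by metis
  qed
  consider (far) "i + 2 \<le> j \<or> j + 2 \<le> i" | (middle) "m = 3" "i \<notin> {0, n}" "j \<notin> {0, n}"
    | (left) "m = 4" "i \<in> {0, n}" "j = (if i = 0 then 1 else n - 1)"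
    | (right) "m = 4" "j \<in> {0, n}" "i = (if j = 0 then 1 else n - 1)"
  proof (cases "i + 2 \<le> j \<or> j + 2 \<le> i")
    case False
    define l where "l = min i j"
    have l: "i = l \<and> j = Suc l \<or> j = l \<and> i = Suc l" "l < n"
      using False assms(1-3) unfolding l_def by linarith+
    have m: "m = (if l \<in> {0, n - 1} then 4 else 3)"
      unfolding m_def coxeter_order_def using l(1) by auto
    from l m middle left right rank show ?thesis by (cases "l = 0"; cases "Suc l = n") auto
  qed (rule far)
  then show ?thesis
  proof cases
    case far
    then have "m = 2" by (simp add: m_def coxeter_order_def)
    then show ?thesis
      using T_commute[OF assms(1,2) far] shorter_0 by (simp add: T_word_def eval_nat_numeral)
  next
    case middle
    then show ?thesis
      using T_braid_three[of i j] assms shorter_0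
      by (simp add: T_word_def eval_nat_numeral mult.assoc)
  next
    case left
    then show ?thesis using four[of i j] by simp
  next
    case right
    then show ?thesis using four[of j i] by simp
  qed
qed

lemma braid_equiv_T_word:
  assumes "braid_equiv n u v"
  shows "length u = length v \<and> set u \<subseteq> {0..n} \<and> TW u - TW v \<in> shorter (length u)"
  using assms
proof induction
  case (braid_equiv_refl u)
  then show ?case by (simp add: shorter_0)
next
  case (braid_equiv_trans u v w)
  then show ?case using shorter_add[of "TW u - TW v" "length u" "TW v - TW w"] by auto
next
  case (braid_equiv_move i j a b)
  then show ?case
    using shorter_mult[OF T_word_alternating_diff[of i j], of a b] set_alternating[of i n j]
    by (simp add: T_word_append right_diff_distrib left_diff_distrib mult.assoc add.assoc)
qed

lemma T_word_in_span:
  assumes wbar: "\<And>w. w \<in> carrier (affine_weyl n) \<Longrightarrow> reduced_expression w (wbar w)"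
    and "set u \<subseteq> {0..n}"
  shows "TW u \<in> span ((\<lambda>w. TW (wbar w)) ` carrier (affine_weyl n))" (is "_ \<in> ?V")
  using assms(2)
proof (induction "length u" arbitrary: u rule: less_induct)
  case less
  \<comment> \<open>The induction hypothesis for all shorter words at once, so that it remains to
    work modulo \<open>shorter (length u)\<close>.\<close>
  have shorter: "shorter (length u) \<subseteq> ?V"
    unfolding shorter_def using less.hyps by (intro span_minimal) auto
  show ?case
  proof (cases "reduced_word n u")
    case True
    define w where "w = word_class n u"
    have w: "w \<in> carrier (affine_weyl n)" unfolding w_def by (rule word_class_in_carrier[OF less.prems])
    note wbar = reduced_expressionD[OF wbar[OF w] w rank]
    have eq: "word_equiv n u (wbar w)"
      using wbar(1) word_class_eq_iff[OF less.prems] by (simp add: w_def)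
    then have "length (wbar w) = length u"
      using True wbar(2) word_equiv_sym[OF eq] eq unfolding reduced_word_def by (blast intro: order_antisym)
    from braid_equiv_T_word[OF reduced_words_braid_equiv[OF True eq this rank]] shorter
    have "TW u - TW (wbar w) \<in> ?V" by blast
    moreover have "TW (wbar w) \<in> ?V" using w by (intro span_base) blast
    ultimately have "TW u - TW (wbar w) + TW (wbar w) \<in> ?V" by (rule span_add)
    then show ?thesis by simp
  next
    case False
    from nonreduced_word_braid_equiv[OF False less.prems rank] obtain a i b
      where ab: "i \<le> n" "set a \<subseteq> {0..n}" "set b \<subseteq> {0..n}" "Suc (Suc (length a + length b)) = length u"
        "braid_equiv n u (a @ i # i # b)" by blast
    obtain c where c: "T i * T i = sc c 1" using T_square_scalar[OF ab(1)] by blast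
    have "TW (a @ i # i # b) = TW a * (T i * T i) * TW b"
      by (simp add: T_word_def mult.assoc)
    also have "\<dots> = sc c (TW (a @ b))"
      unfolding c by (simp add: scale_mult_left scale_mult_right T_word_append)
    finally have "TW (a @ i # i # b) \<in> shorter (length u)"
      using ab by (simp add: shorter_scale shorter_T_word)
    moreover have "TW u - TW (a @ i # i # b) \<in> shorter (length u)"
      using braid_equiv_T_word[OF ab(5)] by blast
    ultimately have "TW u - TW (a @ i # i # b) + TW (a @ i # i # b) \<in> shorter (length u)"
      by (intro shorter_add)
    with shorter show ?thesis by auto
  qed
qed

text \<open>The span of all products contains the generators and is closed under multiplication, by
  bilinearity and concatenation of words. Conversely every subalgebra containing the generators
  contains all products.\<close>

lemma H_alg_eq_span: "H_alg sc n t0 u0 tn un \<rho> X = span {TW u | u. set u \<subseteq> {0..n}}" (is "_ = span ?W")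
proof -
  have mult: "x * y \<in> span ?W" if x: "x \<in> span ?W" and y: "y \<in> span ?W" for x y
    using x
  proof (induction rule: span_induct_alt)
    case base
    then show ?case by (simp add: span_zero)
  next
    case (step c w z)
    then obtain u where u: "set u \<subseteq> {0..n}" "w = TW u" by blast
    have "w * y \<in> span ?W"
      using y
    proof (induction rule: span_induct_alt)
      case base
      then show ?case by (simp add: span_zero)
    next
      case (step d v y)
      then obtain u' where u': "set u' \<subseteq> {0..n}" "v = TW u'" by blast
      have "w * v = TW (u @ u')" "set (u @ u') \<subseteq> {0..n}"
        using u u' by (simp_all add: T_word_append)
      then have "w * v \<in> span ?W" by (intro span_base) blast
      with step show ?case by (simp add: distrib_left scale_mult_right span_add span_scale)
    qed
    with step show ?case by (simp add: distrib_right scale_mult_left span_add span_scale)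
  qed
  have one: "TW [] = 1" by (simp add: T_word_def)
  show ?thesis
    unfolding H_alg_def
  proof (rule hull_unique)
    have "T i \<in> ?W" if "i \<in> {0..n}" for i
      using that by (auto simp: T_word_def intro!: exI[of _ "[i]"])
    then show "T ` {0..n} \<subseteq> span ?W" by (auto intro: span_base)
    have "1 \<in> span ?W" unfolding one[symmetric] by (rule span_base) (auto intro!: exI[of _ "[]"])
    then show "unital_subalgebra sc (span ?W)"
      using mult by (simp add: unital_subalgebra_def)
  next
    fix A assume A: "T ` {0..n} \<subseteq> A" "unital_subalgebra sc A"
    have "T i \<in> A" if "i \<le> n" for i using that A(1) by auto
    then have "TW u \<in> A" if "set u \<subseteq> {0..n}" for u
      using that A(2) by (induction u) (auto simp: T_word_def unital_subalgebra_def)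
    then show "span ?W \<subseteq> A"
      using A(2) by (intro span_minimal) (auto simp: unital_subalgebra_def)
  qed
qed

end

section \<open>From the indexed family to a basis of \<open>H_alg\<close>\<close>

theorem proposition2p3:
  fixes sc :: "complex \<Rightarrow> 'a::ring_1 \<Rightarrow> 'a"
    and n :: nat and t0 u0 t tn un :: complex
    and \<rho> :: "nat list set \<Rightarrow> 'a" and X :: "nat \<Rightarrow> 'a"
    and wbar :: "nat list set \<Rightarrow> nat list"
  assumes "n \<ge> 2"
    and "degenerate_daha sc n t0 u0 t tn un \<rho> X"
    and "\<And>w. w \<in> carrier (affine_weyl n) \<Longrightarrow> reduced_expression w (wbar w)"
  shows "inj_on (\<lambda>w. T_word sc n t0 u0 tn un \<rho> X (wbar w)) (carrier (affine_weyl n))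
    \<and> \<not> module.dependent sc
          ((\<lambda>w. T_word sc n t0 u0 tn un \<rho> X (wbar w)) ` carrier (affine_weyl n))
    \<and> module.span sc
          ((\<lambda>w. T_word sc n t0 u0 tn un \<rho> X (wbar w)) ` carrier (affine_weyl n))
        = H_alg sc n t0 u0 tn un \<rho> X"
proof -
  interpret daha sc n t0 u0 t tn un \<rho> X
    using assms(1,2) by (simp add: daha_def daha_axioms_def)
  let ?f = "\<lambda>w. TW (wbar w)" and ?W = "carrier (affine_weyl n)"
  note indep = T_words_independent[of wbar, OF assms(3)]
  have inj: "inj_on ?f ?W"
  proof (rule inj_onI, rule ccontr)
    fix v w assume vw: "v \<in> ?W" "w \<in> ?W" "?f v = ?f w" "v \<noteq> w"
    \<comment> \<open>Equal products for \<open>v \<noteq> w\<close> would give a linear relation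
      with coefficients \<open>1\<close> at \<open>v\<close> and \<open>- 1\<close> at
      \<open>w\<close>; the claim is that its coefficient at \<open>v\<close> vanishes.\<close>
    have "(if v = v then 1 else - 1 :: complex) = 0"
      by (rule indep[where S = "{v, w}" and c = "\<lambda>x. if x = v then 1 else - 1"]) (use vw in auto)
    then show False by simp
  qed
  moreover have "independent (?f ` ?W)"
    unfolding independent_explicit_finite_subsets
  proof (intro allI impI ballI)
    fix S c y assume S: "S \<subseteq> ?f ` ?W" "finite S" "(\<Sum>x\<in>S. sc (c x) x) = 0" "y \<in> S"
    \<comment> \<open>A relation among values is pulled back to one among group elements;
      injectivity ensures that each value is counted once.\<close>
    from S(1,2) inj obtain A where A: "A \<subseteq> ?W" "finite A" "S = ?f ` A"
      by (metis finite_subset_image)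
    have "inj_on ?f A" using inj A(1) by (rule inj_on_subset)
    with S(3) have "(\<Sum>w\<in>A. sc (c (?f w)) (?f w)) = 0"
      unfolding A(3) by (simp add: sum.reindex)
    with A S(4) show "c y = 0" using indep[of A "\<lambda>w. c (?f w)"] by blast
  qed
  moreover have "span (?f ` ?W) = H_alg sc n t0 u0 tn un \<rho> X"
    unfolding H_alg_eq_span
  proof (rule order_antisym; rule span_minimal)
    show "?f ` ?W \<subseteq> span {TW u |u. set u \<subseteq> {0..n}}"
    proof safe
      fix w assume w: "w \<in> ?W"
      then have "set (wbar w) \<subseteq> {0..n}"
        using reduced_expressionD(2)[OF assms(3)] assms(1) by (simp add: reduced_word_def)
      then show "?f w \<in> span {TW u |u. set u \<subseteq> {0..n}}" by (auto intro: span_base)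
    qed
    show "{TW u |u. set u \<subseteq> {0..n}} \<subseteq> span (?f ` ?W)"
      using T_word_in_span[of wbar, OF assms(3)] by blast
  qed simp_all
  ultimately show ?thesis by blast
qed

end
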